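(* Let $G=(V,E)$ be a directed simple graph (no loops, no multiple edges) on vertex set $V=[n]$, which is strongly connected, and consider the associated linear compartment model in which input and output take place only in compartment $1$ and every compartment has a leak whose parameter is independent of all other parameters. Then $G$ has an identifiable scaling reparametrization if and only if the matrix $B(G)$, with rows indexed by $R=\{(k,l): k,l\in[n],\ k\neq l,\ l\to k\notin E\}$, columns indexed by $L=\{(i,j): i,j\in\{2,\ldots,n\},\ i\neq j\}$, and entries \[ B(G)_{(k,l),(i,j)}=\begin{cases}-a_{jl} & \text{if } i=k,\ j\neq l \text{ and } l\to j\in E,\\ a_{ki} & \text{if } i\neq k,\ j=l \text{ and } i\to k\in E,\\ a_{kk}-a_{ll} & \text{if } i=k \text{ and } j=l,\\ 0 & \text{otherwise,}\end{cases} \] has full column rank (i.e. rank $|L|$, as a matrix whose entries are the symbolic parameters $a_{ij}$, equivalently at a generic parameter point).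
   Context: The parameter matrix of $G$ is the $n\times n$ matrix $A=A(G)$ with $A_{ii}=a_{ii}$, $A_{ij}=a_{ij}$ if $j\to i\in E$, and $A_{ij}=0$ otherwise, where $a_{ij}$ ($j\to i\in E$) is the transfer rate from compartment $j$ to $i$ and $a_{ii}=-a_{0i}-\sum_{j\neq i}a_{ji}$ with $a_{0i}$ the leak of compartment $i$; under the assumptions all $n+m$ nonzero entries ($m=|E|$) are independent parameters. The parameter space $\Theta_G$ is the set of all real matrices with this zero pattern. The model is $\dot x=Ax+u$, $y=x_1$, with $u=(u_1,0,\ldots,0)^T$; its input-output equation is $y^{(n)}+c_1y^{(n-1)}+\cdots+c_ny=u_1^{(n-1)}+d_1u_1^{(n-2)}+\cdots+d_{n-1}u_1$, where $c_1,\ldots,c_n$ and $d_1,\ldots,d_{n-1}$ are the non-leading coefficients of the characteristic polynomials of $A$ and of $A_1$ ($A$ with first row and column deleted). The double characteristic polynomial map is $c:\Theta_G\to\mathbb{R}^{2n-1}$, $c(A)=(c_1,\ldots,c_n,d_1,\ldots,d_{n-1})$. A map $f$ on a parameter space $\Theta$ is identifiable if there is a dense subset $U\subseteq\Theta$ such that each point of $U$ has a neighborhood on which $f$ is injective. A scaling reparametrization consists of functions $f_1,\ldots,f_n:\Theta_G\to\mathbb{R}$ with $f_1\equiv 1$; it sends $A$ to $B=(b_{ij})$ with $b_{ij}=a_{ij}f_i(A)/f_j(A)$ (so $c(B)=c(A)$), and $c$ induces a map $\bar c$ on the image $\Theta'$ of $A\mapsto B$. The scaling reparametrization is identifiable if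 $\bar c:\Theta'\to\mathbb{R}^{2n-1}$ is identifiable.
   Formalization: The functions f_i of a scaling reparametrization are required to be continuous and nonzero on a dense open subset of the parameter space, and Θ' is the image of that subset; with arbitrary functions the claim fails for the complete digraph on 3 vertices. *)

theory Defs
  imports
    "HOL-Analysis.Analysis"
    "HOL-Library.Poly_Mapping"
    "HOL-Computational_Algebra.Polynomial"
    "HOL-Computational_Algebra.Fraction_Field"
begin

text \<open>
  The vertex set $[n]$ is the finite type \<open>'n\<close>, compartment $1$ is a designated vertex \<open>r\<close>, and
  \<open>E\<close> is the set of pairs \<open>(j, i)\<close> with $j \to i$ an edge. Matrices are indexed as \<open>A $ row $ column\<close>.
\<close>

definition simple_digraph :: "('n \<times> 'n) set \<Rightarrow> bool"
  where "simple_digraph E \<longleftrightarrow> (\<forall>v. (v, v) \<notin> E)"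

definition strongly_connected :: "('n \<times> 'n) set \<Rightarrow> bool"
  where "strongly_connected E \<longleftrightarrow> (\<forall>u v. (u, v) \<in> E\<^sup>*)"

text \<open>
  Every compartment has its own independent leak, so the diagonal entries are unconstrained and the
  parameter space is a real vector space of dimension $n + m$ (an edge parameter may be zero).
\<close>

definition param_space :: "('n::finite \<times> 'n) set \<Rightarrow> (real^'n^'n) set"
  where "param_space E = {A. \<forall>i j. i \<noteq> j \<and> (j, i) \<notin> E \<longrightarrow> A $ i $ j = 0}"


subsection \<open>The double characteristic polynomial map\<close>

text \<open>
  Determinant and characteristic polynomial of the principal submatrix with rows and columns in \<open>S\<close>
  (Leibniz formula over the permutations of \<open>S\<close>); the lemmas below relate them to \<open>det\<close>.
\<close>

definition det_on :: "'n set \<Rightarrow> ('n \<Rightarrow> 'n \<Rightarrow> 'a::comm_ring_1) \<Rightarrow> 'a"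
  where "det_on S M = (\<Sum>p | p permutes S. of_int (sign p) * (\<Prod>i\<in>S. M i (p i)))"

definition charpoly_on :: "'n set \<Rightarrow> real^'n^'n \<Rightarrow> real poly"
  where "charpoly_on S A =
    det_on S (\<lambda>i j. (if i = j then [:0, 1:] else 0) - [:A $ i $ j:])"

text \<open>
  The list $(c_1, \ldots, c_n, d_1, \ldots, d_{n-1})$, where $c_k$ is the coefficient of $x^{n-k}$ in
  the characteristic polynomial of \<open>A\<close>, and $d_k$ the coefficient of $x^{n-1-k}$ in that of \<open>A\<close> with
  row and column \<open>r\<close> deleted.
\<close>

definition double_charpoly :: "'n::finite \<Rightarrow> real^'n^'n \<Rightarrow> real list"
  where "double_charpoly r A =
    map (\<lambda>k. coeff (charpoly_on UNIV A) (CARD('n) - k)) [1..<CARD('n) + 1] @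
    map (\<lambda>k. coeff (charpoly_on (UNIV - {r}) A) (CARD('n) - 1 - k)) [1..<CARD('n)]"


subsection \<open>Identifiable scaling reparametrizations\<close>

definition identifiable_on :: "'a::topological_space set \<Rightarrow> ('a \<Rightarrow> 'b) \<Rightarrow> bool"
  where "identifiable_on \<Theta> f \<longleftrightarrow>
    (\<exists>U\<subseteq>\<Theta>. \<Theta> \<subseteq> closure U \<and>
      (\<forall>x\<in>U. \<exists>N. openin (top_of_set \<Theta>) N \<and> x \<in> N \<and> inj_on f N))"

definition rescale :: "('n \<Rightarrow> real^'n^'n \<Rightarrow> real) \<Rightarrow> real^'n^'n \<Rightarrow> real^'n^'n"
  where "rescale f A = (\<chi> i j. A $ i $ j * f i A / f j A)"

text \<open>
  The matrix $B = (a_{ij} f_i(A) / f_j(A))$ only makes sense, and only satisfies $c(B) = c(A)$, where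
  no $f_i$ vanishes.
\<close>

definition scaling_domain ::
    "('n::finite \<times> 'n) set \<Rightarrow> ('n \<Rightarrow> real^'n^'n \<Rightarrow> real) \<Rightarrow> (real^'n^'n) set"
  where "scaling_domain E f = {A \<in> param_space E. \<forall>i. f i A \<noteq> 0}"

text \<open>
  The functions $f_i$ are understood generically, as for Laurent monomials in the parameters: they
  have to be continuous and nonzero on a dense open subset of the parameter space. A function that
  is undefined at some \<open>A\<close> is given the value \<open>0\<close> there (for example \<open>1 / A $ i $ j\<close>), which
  excludes \<open>A\<close> from the domain. Without continuity the notion degenerates: arbitrary choices of
  representatives in the scaling orbits can yield images with a dense set of isolated points, on
  which every map is identifiable. Requiring continuity and nonvanishing on the whole vector space would
  rule out even the graph consisting of a single 2-cycle.
\<close>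

definition scaling_reparametrization ::
    "('n::finite \<times> 'n) set \<Rightarrow> 'n \<Rightarrow> ('n \<Rightarrow> real^'n^'n \<Rightarrow> real) \<Rightarrow> bool"
  where "scaling_reparametrization E r f \<longleftrightarrow>
    (\<forall>A\<in>param_space E. f r A = 1) \<and>
    openin (top_of_set (param_space E)) (scaling_domain E f) \<and>
    param_space E \<subseteq> closure (scaling_domain E f) \<and>
    (\<forall>i. continuous_on (scaling_domain E f) (f i))"

text \<open>
  The image is the $\Theta'$ of the map $A \mapsto B$. By \<open>double_charpoly_rescale\<close> below, the map
  induced on it is the restriction of \<open>double_charpoly r\<close>.
\<close>

definition has_identifiable_scaling_reparametrization :: "('n::finite \<times> 'n) set \<Rightarrow> 'n \<Rightarrow> bool"
  where "has_identifiable_scaling_reparametrization E r \<longleftrightarrow>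
    (\<exists>f. scaling_reparametrization E r f \<and>
      identifiable_on (rescale f ` scaling_domain E f) (double_charpoly r))"


subsection \<open>The matrix $B(G)$\<close>

definition B_rows :: "('n \<times> 'n) set \<Rightarrow> ('n \<times> 'n) set"
  where "B_rows E = {(k, l). k \<noteq> l \<and> (l, k) \<notin> E}"

definition B_cols :: "'n \<Rightarrow> ('n \<times> 'n) set"
  where "B_cols r = {(i, j). i \<noteq> r \<and> j \<noteq> r \<and> i \<noteq> j}"

definition B_entry ::
    "('n \<times> 'n) set \<Rightarrow> ('n \<Rightarrow> 'n \<Rightarrow> 'a::ab_group_add) \<Rightarrow> 'n \<times> 'n \<Rightarrow> 'n \<times> 'n \<Rightarrow> 'a"
  where "B_entry E a = (\<lambda>(k, l) (i, j).
    if i = k \<and> j \<noteq> l \<and> (l, j) \<in> E then - a j l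
    else if i \<noteq> k \<and> j = l \<and> (i, k) \<in> E then a k i
    else if i = k \<and> j = l then a k k - a l l
    else 0)"

text \<open>
  Rows outside \<open>B_rows E\<close> and columns outside \<open>B_cols r\<close> are zero padding, which has no influence
  on the rank.
\<close>

definition B_matrix ::
    "('n::finite \<times> 'n) set \<Rightarrow> 'n \<Rightarrow> ('n \<Rightarrow> 'n \<Rightarrow> 'a::ab_group_add) \<Rightarrow> 'a^('n \<times> 'n)^('n \<times> 'n)"
  where "B_matrix E r a =
    (\<chi> kl ij. if kl \<in> B_rows E \<and> ij \<in> B_cols r then B_entry E a kl ij else 0)"

text \<open>
  The symbolic parameter $a_{ij}$ is the indeterminate with number \<open>to_nat (i, j)\<close> in the field of
  rational functions over the reals: \<open>nat \<Rightarrow>\<^sub>0 nat\<close> is the type of exponent vectors and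
  \<open>(nat \<Rightarrow>\<^sub>0 nat) \<Rightarrow>\<^sub>0 real\<close> the polynomial ring.
\<close>

type_synonym ratfun = "((nat \<Rightarrow>\<^sub>0 nat) \<Rightarrow>\<^sub>0 real) fract"

definition symbolic_param :: "'n::finite \<Rightarrow> 'n \<Rightarrow> ratfun"
  where "symbolic_param i j =
    Fract (Poly_Mapping.single (Poly_Mapping.single (to_nat (i, j)) 1) 1) 1"

definition B_full_column_rank :: "('n::finite \<times> 'n) set \<Rightarrow> 'n \<Rightarrow> bool"
  where "B_full_column_rank E r \<longleftrightarrow>
    rank (B_matrix E r symbolic_param :: ratfun^('n \<times> 'n)^('n \<times> 'n)) = card (B_cols r)"


subsection \<open>Basic facts\<close>

lemma det_on_UNIV: "det_on UNIV (\<lambda>i j. M $ i $ j) = det M"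
  by (simp add: det_on_def det_def)

lemma det_on_image:
  fixes e :: "'m::finite \<Rightarrow> 'n::finite"
  assumes e: "bij_betw e UNIV S"
  shows "det_on S M = det (\<chi> i j. M (e i) (e j))"
proof -
  let ?h = "map_permutation UNIV e"
  let ?g = "map_permutation S (inv_into UNIV e)"
  have e': "bij_betw (inv_into UNIV e) S UNIV"
    by (rule bij_betw_inv_into[OF e])
  have inj: "inj e"
    using e by (simp add: bij_betw_def)
  have "(\<Sum>p | p permutes S. of_int (sign p) * (\<Prod>i\<in>S. M i (p i))) =
        (\<Sum>p | p permutes (UNIV :: 'm set). of_int (sign p) * (\<Prod>i\<in>UNIV. M (e i) (e (p i))))"
  proof (rule sum.reindex_bij_witness[of _ ?h ?g])
    fix p assume "p \<in> {p. p permutes S}"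
    then have p: "p permutes S" by simp
    show hg: "?h (?g p) = p"
      by (rule map_permutation_compose_inv[OF e' p])
        (use e in \<open>auto simp: bij_betw_def f_inv_into_f\<close>)
    show g: "?g p \<in> {p. p permutes UNIV}"
      using map_permutation_permutes[OF e' p] by simp
    have sg: "sign (?g p) = sign p"
      using sign_map_permutation[of "inv_into UNIV e" S p] e' p by (auto simp: bij_betw_def)
    have "(\<Prod>i\<in>S. M i (p i)) = (\<Prod>i\<in>UNIV. M (e i) (p (e i)))"
      using prod.reindex_bij_betw[OF e, of "\<lambda>i. M i (p i)"] by simp
    also have "\<dots> = (\<Prod>i\<in>UNIV. M (e i) (e (?g p i)))"
    proof (rule prod.cong[OF refl])
      fix i
      have "p (e i) = ?h (?g p) (e i)" by (simp only: hg)
      also have "\<dots> = e (?g p i)"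
        using inj by (simp add: map_permutation_apply)
      finally show "M (e i) (p (e i)) = M (e i) (e (?g p i))" by simp
    qed
    finally show "of_int (sign (?g p)) * (\<Prod>i\<in>UNIV. M (e i) (e (?g p i))) =
        of_int (sign p) * (\<Prod>i\<in>S. M i (p i))"
      by (simp add: sg)
  next
    fix p assume "p \<in> {p. p permutes (UNIV :: 'm set)}"
    then have p: "p permutes (UNIV :: 'm set)" by simp
    show "?g (?h p) = p"
      by (rule map_permutation_compose_inv[OF e p]) (use inj in simp)
    show "?h p \<in> {p. p permutes S}"
      using map_permutation_permutes[OF e p] by simp
  qed
  then show ?thesis by (simp add: det_on_def det_def)
qed

lemma det_on_scale:
  fixes M :: "'n::finite \<Rightarrow> 'n \<Rightarrow> 'a::comm_ring_1"
  assumes "\<And>i. g i * h i = 1"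
  shows "det_on S (\<lambda>i j. M i j * g i * h j) = det_on S M"
  unfolding det_on_def
proof (rule sum.cong[OF refl])
  fix p assume "p \<in> {p. p permutes S}"
  then have "(\<Prod>i\<in>S. h (p i)) = (\<Prod>i\<in>S. h i)"
    using prod.permute[of p S h] by (simp add: o_def)
  then have "(\<Prod>i\<in>S. M i (p i) * g i * h (p i)) = (\<Prod>i\<in>S. M i (p i)) * (\<Prod>i\<in>S. g i * h i)"
    by (simp add: prod.distrib mult.assoc)
  then show "of_int (sign p) * (\<Prod>i\<in>S. M i (p i) * g i * h (p i)) =
      of_int (sign p) * (\<Prod>i\<in>S. M i (p i))"
    by (simp add: assms)
qed

lemma double_charpoly_rescale:
  assumes nz: "\<And>i. f i A \<noteq> 0"
  shows "double_charpoly r (rescale f A) = double_charpoly r A"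
proof -
  have "charpoly_on S (rescale f A) = charpoly_on S A" for S
  proof -
    have "(if i = j then [:0, 1:] else 0) - [:rescale f A $ i $ j:] =
        ((if i = j then [:0, 1:] else 0) - [:A $ i $ j:]) * [:f i A:] * [:1 / f j A:]" for i j
      using nz[of j] by (auto simp: rescale_def)
    then have "charpoly_on S (rescale f A) = det_on S
        (\<lambda>i j. ((if i = j then [:0, 1:] else 0) - [:A $ i $ j:]) * [:f i A:] * [:1 / f j A:])"
      by (simp add: charpoly_on_def)
    also have "\<dots> = charpoly_on S A"
      unfolding charpoly_on_def by (rule det_on_scale) (simp add: nz one_pCons)
    finally show ?thesis .
  qed
  then show ?thesis by (simp add: double_charpoly_def)
qed

end

theory Submission
  imports Defs "HOL-Computational_Algebra.Polynomial_Factorial"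
begin

text \<open>
  Write \<open>e\<close> for the unit vector of compartment \<open>r\<close>. If \<open>e\<close> is a cyclic vector of both \<open>A\<close> and
  its transpose, which holds generically on the parameter space of a strongly connected graph, then
  the fiber of the double characteristic polynomial map through \<open>A\<close> consists of the matrices
  \<open>T A T\<^sup>-\<^sup>1\<close> where \<open>T\<close> fixes \<open>e\<close> from the left and from the right: the map determines the
  Markov parameters \<open>e\<^sup>T A\<^sup>k e\<close>, and a minimal realization is unique. Its tangent space at \<open>A\<close>
  is formed by the commutators \<open>X A - A X\<close> where row and column \<open>r\<close> of \<open>X\<close> vanish. Diagonal \<open>X\<close>
  give the directions of the scaling orbit, and \<open>- B(G)\<close> is the matrix of the map that sends the
  off-diagonal part of \<open>X\<close> to the entries of the commutator outside the zero pattern. Hence \<open>B(G)\<close>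
  has full column rank at \<open>A\<close> iff the fiber, inside the parameter space, is infinitesimally just
  the scaling orbit.

  If so, normalizing the entries of a spanning tree rooted at \<open>r\<close> to \<open>1\<close> is an identifiable
  scaling reparametrization: if \<open>A' = T A T\<^sup>-\<^sup>1\<close> and \<open>X = T - 1\<close>, then \<open>X A - A' X = A' - A\<close> is
  tangent to the slice, which forces \<open>X = 0\<close> when \<open>A\<close> and \<open>A'\<close> are close to a good point.

  Conversely, given an identifiable scaling reparametrization, continuity makes equal values of the
  map on some open set imply equal scaling orbits. So the map (augmented by the tree entries) is
  injective there, and an injective \<open>C\<^sup>1\<close> map is an immersion at some point; at that point no
  off-diagonal \<open>X\<close> is left in the kernel of \<open>B(G)\<close>.
\<close>


subsection \<open>Injective smooth maps and polynomial functions\<close>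

text \<open>Where the rank of the derivative is maximal it is locally constant, so a nonzero kernel
  vector there would integrate to a curve along which \<open>f\<close> is constant, against
  injectivity.\<close>

lemma inj_C1_imp_inj_derivative:
  fixes f :: "'a::euclidean_space \<Rightarrow> 'b::euclidean_space" and f' :: "'a \<Rightarrow> 'a \<Rightarrow>\<^sub>L 'b"
  assumes "open W" "W \<noteq> {}" "inj_on f W"
    and derf: "\<And>x. x \<in> W \<Longrightarrow> (f has_derivative blinfun_apply (f' x)) (at x)"
    and contf: "continuous_on W f'"
  shows "\<exists>x\<in>W. inj (blinfun_apply (f' x))"
proof -
  define K where "K x = {v. blinfun_apply (f' x) v = 0}" for x
  have subK: "subspace (K x)" for x
    unfolding K_def subspace_def by (auto simp: blinfun.bilinear_simps)
  \<comment> \<open>Minimal kernel dimension means maximal rank; a minimum exists because dimensions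
    are natural numbers.\<close>
  obtain x0 where x0: "x0 \<in> W" and min: "\<And>y. y \<in> W \<Longrightarrow> dim (K x0) \<le> dim (K y)"
    using ex_has_least_nat[of "\<lambda>x. x \<in> W" _ "\<lambda>x. dim (K x)"] \<open>W \<noteq> {}\<close> by blast
  define K' where "K' = {v. \<forall>u\<in>K x0. orthogonal u v}"
  have subK': "subspace K'"
    unfolding K'_def by (rule subspace_orthogonal_to_vectors)
  have ortho: "K x0 \<inter> K' \<subseteq> {0}"
    by (auto simp: K'_def orthogonal_def)
  have lin: "linear (blinfun_apply (f' x))" for x
    using blinfun.bounded_linear_right[of "f' x"] by (rule bounded_linear.linear)
  have "inj_on (blinfun_apply (f' x0)) K'"
    using ortho linear_inj_on_iff_eq_0[OF lin subK'] by (auto simp: K_def)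
  then obtain Q where Q: "range Q \<subseteq> K'" "linear Q"
      and QK': "\<And>v. v \<in> K' \<Longrightarrow> Q (blinfun_apply (f' x0) v) = v"
    using linear_exists_left_inverse_on[OF lin subK'] by blast
  define p where "p v = v - Q (blinfun_apply (f' x0) v)" for v
  have QK: "Q (blinfun_apply (f' x0) v) = 0" if "v \<in> K x0" for v
    using that linear_0[OF Q(2)] by (simp add: K_def)
  have linp: "linear p"
    unfolding p_def
    by (intro linear_compose_sub linear_ident linear_compose[OF lin Q(2), unfolded o_def])
  have p_K: "p v \<in> K x0" for v
  proof -
    obtain y z where yz: "y \<in> span (K x0)" "\<And>w. w \<in> span (K x0) \<Longrightarrow> orthogonal z w" "v = y + z"
      using orthogonal_subspace_decomp_exists[of "K x0" v] by blast
    have y: "y \<in> K x0" using yz(1) subK by (simp add: span_eq_iff[THEN iffD2])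
    have z: "z \<in> K'" using yz(2) by (auto simp: K'_def orthogonal_commute span_base)
    have "Q (blinfun_apply (f' x0) v) = z"
      using QK[OF y] QK'[OF z] by (simp add: yz(3) blinfun.bilinear_simps linear_add[OF Q(2)])
    then show ?thesis using y yz(3) by (simp add: p_def)
  qed
  have bQ: "bounded_linear Q" and bp: "bounded_linear p"
    using Q(2) linp by (auto simp: linear_conv_bounded_linear)
  \<comment> \<open>\<open>Q\<close> inverts the derivative at \<open>x0\<close> on the complement
    \<open>K'\<close> and \<open>p\<close> projects onto the kernel. Hence \<open>F\<close> has the
    identity as derivative at \<open>x0\<close> and is a local diffeomorphism.\<close>
  define F where "F x = Q (f x) + p x" for x
  define F' where "F' x = (Blinfun Q o\<^sub>L f' x) + Blinfun p" for x
  have F'_app: "blinfun_apply (F' x) v = Q (blinfun_apply (f' x) v) + p v" for x v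
    by (simp add: F'_def blinfun.bilinear_simps bounded_linear_Blinfun_apply bQ bp)
  have derF: "(F has_derivative blinfun_apply (F' x)) (at x)" if "x \<in> W" for x
    unfolding F_def F'_app
    by (intro has_derivative_add bounded_linear.has_derivative[OF bQ] derf that
        bounded_linear_imp_has_derivative bp)
  have contF: "continuous_on W F'"
    unfolding F'_def
    by (intro continuous_on_add bounded_bilinear.continuous_on[OF bounded_bilinear_blinfun_compose]
        contf continuous_on_const)
  have "id_blinfun o\<^sub>L F' x0 = id_blinfun"
    by (rule blinfun_eqI) (simp add: F'_app p_def)
  from inverse_function_theorem[OF \<open>open W\<close> derF contF x0 this]
  obtain U V g g' where U: "open U" "U \<subseteq> W" "x0 \<in> U" and V: "open V" "F x0 \<in> V"
    and hom: "homeomorphism U V F g"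
    and derg: "\<And>y. y \<in> V \<Longrightarrow> (g has_derivative (g' y)) (at y)"
    and bij: "\<And>y. y \<in> V \<Longrightarrow> bij (blinfun_apply (F' (g y)))"
    by metis
  have gU: "g y \<in> U" and Fg: "F (g y) = y" if "y \<in> V" for y
    using hom that by (auto simp: homeomorphism_def)
  \<comment> \<open>Since \<open>F' x\<close> is injective, \<open>p\<close> embeds the kernel of
    \<open>Q\<close> after \<open>f' x\<close> into \<open>K x0\<close>. Minimality of
    \<open>dim (K x0)\<close> then leaves no room between that kernel and
    \<open>K x\<close>.\<close>
  have ker_Q: "blinfun_apply (f' x) v = 0"
    if x: "x \<in> U" and v: "Q (blinfun_apply (f' x) v) = 0" for x v
  proof -
    define Z where "Z = {v. Q (blinfun_apply (f' x) v) = 0}"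
    have subZ: "subspace Z"
      unfolding Z_def subspace_def
      by (auto simp: blinfun.bilinear_simps linear_add[OF Q(2)] linear_cmul[OF Q(2)] linear_0[OF Q(2)])
    have "F x \<in> V" "g (F x) = x" using hom x by (auto simp: homeomorphism_def)
    then have "inj (blinfun_apply (F' x))" using bij[of "F x"] by (simp add: bij_def)
    moreover have "blinfun_apply (F' x) a = blinfun_apply (F' x) b"
      if "a \<in> Z" "b \<in> Z" "p a = p b" for a b
      using that by (simp add: Z_def F'_app)
    ultimately have "inj_on p Z"
      by (meson injD inj_onI)
    then have "dim Z = dim (p ` Z)"
      using dim_image_eq[OF linp, of Z] span_eq_iff[THEN iffD2, OF subZ] by simp
    also have "\<dots> \<le> dim (K x0)" using p_K by (intro dim_subset) auto
    also have "\<dots> \<le> dim (K x)" using min x U by auto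
    finally have "dim Z \<le> dim (K x)" .
    moreover have "K x \<subseteq> Z" by (auto simp: K_def Z_def linear_0[OF Q(2)])
    ultimately have "K x = Z"
      using subspace_dim_equal[OF subK subZ] by blast
    then show ?thesis using v by (auto simp: K_def Z_def)
  qed
  have "v = 0" if v: "v \<in> K x0" for v
  proof (rule ccontr)
    assume "v \<noteq> 0"
    obtain e where e: "e > 0" "ball (F x0) e \<subseteq> V" using V open_contains_ball by blast
    define \<delta> where "\<delta> = e / (2 * norm v)"
    have \<delta>: "\<delta> > 0" using e \<open>v \<noteq> 0\<close> by (simp add: \<delta>_def)
    have inV: "F x0 + t *\<^sub>R v \<in> V" if "t \<in> {0..\<delta>}" for t
    proof -
      have "norm (t *\<^sub>R v) \<le> \<delta> * norm v" using that by (simp add: mult_right_mono)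
      also have "\<dots> < e" using e \<open>v \<noteq> 0\<close> by (simp add: \<delta>_def)
      finally show ?thesis using e by (auto simp: dist_norm)
    qed
    \<comment> \<open>The preimage under \<open>F\<close> of a segment in the kernel direction
      \<open>v\<close>; \<open>\<delta>\<close> keeps the segment inside the ball contained in
      \<open>V\<close>.\<close>
    define \<gamma> where "\<gamma> = (\<lambda>t. g (F x0 + t *\<^sub>R v))"
    have der\<gamma>: "(\<gamma> has_vector_derivative g' (F x0 + t *\<^sub>R v) v) (at t)" if "t \<in> {0..\<delta>}" for t
    proof -
      have "((\<lambda>t. F x0 + t *\<^sub>R v) has_derivative (\<lambda>s. s *\<^sub>R v)) (at t)"
        by (auto intro!: derivative_eq_intros)
      from diff_chain_at[OF this derg[OF inV[OF that]]]
      have "(\<gamma> has_derivative (\<lambda>s. g' (F x0 + t *\<^sub>R v) (s *\<^sub>R v))) (at t)"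
        by (simp add: \<gamma>_def o_def)
      moreover have "linear (g' (F x0 + t *\<^sub>R v))"
        using derg[OF inV[OF that]] has_derivative_linear by blast
      ultimately show ?thesis by (simp add: has_vector_derivative_def linear_cmul)
    qed
    have \<gamma>U: "\<gamma> t \<in> U" and F\<gamma>: "F (\<gamma> t) = F x0 + t *\<^sub>R v" if "t \<in> {0..\<delta>}" for t
      using gU[OF inV[OF that]] Fg[OF inV[OF that]] by (auto simp: \<gamma>_def)
    have "f (\<gamma> t) = f (\<gamma> 0)" if t: "t \<in> {0..\<delta>}" for t
    proof (rule has_derivative_zero_unique[of "{0..\<delta>}" "\<lambda>t. f (\<gamma> t)"])
      fix s assume s: "s \<in> {0..\<delta>}"
      define w where "w = g' (F x0 + s *\<^sub>R v) v"
      have d\<gamma>: "(\<gamma> has_derivative (\<lambda>h. h *\<^sub>R w)) (at s within {0..\<delta>})"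
        using der\<gamma>[OF s] by (simp add: has_vector_derivative_def w_def has_derivative_at_withinI)
      have sW: "\<gamma> s \<in> W" using \<gamma>U[OF s] U by auto
      have "((\<lambda>t. F (\<gamma> t)) has_derivative (\<lambda>h. blinfun_apply (F' (\<gamma> s)) (h *\<^sub>R w))) (at s within {0..\<delta>})"
        using has_derivative_compose[OF d\<gamma> derF[OF sW]] by simp
      moreover have "((\<lambda>t. F (\<gamma> t)) has_derivative (\<lambda>h. h *\<^sub>R v)) (at s within {0..\<delta>})"
      proof (rule has_derivative_transform[OF s])
        show "((\<lambda>t. F x0 + t *\<^sub>R v) has_derivative (\<lambda>h. h *\<^sub>R v)) (at s within {0..\<delta>})"
          by (auto intro!: derivative_eq_intros)
      qed (use F\<gamma> in simp)
      \<comment> \<open>The chain rule and the explicit formula \<open>F\<gamma>\<close> give two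
        derivatives of the same curve. Comparing them puts the \<open>Q\<close> part into both
        \<open>K x0\<close> and \<open>K'\<close>, so it vanishes.\<close>
      ultimately have "(\<lambda>h. blinfun_apply (F' (\<gamma> s)) (h *\<^sub>R w)) = (\<lambda>h. h *\<^sub>R v)"
        using \<delta> s by (intro frechet_derivative_unique_within_closed_interval[of 0 \<delta> s "\<lambda>t. F (\<gamma> t)", unfolded cbox_interval]) (auto simp: Basis_real_def)
      from fun_cong[OF this, of 1] have eq: "Q (blinfun_apply (f' (\<gamma> s)) w) + p w = v"
        by (simp add: F'_app)
      then have "Q (blinfun_apply (f' (\<gamma> s)) w) = v - p w" by (simp add: algebra_simps)
      moreover have "v - p w \<in> K x0" using subspace_diff[OF subK v p_K] .
      moreover have "Q (blinfun_apply (f' (\<gamma> s)) w) \<in> K'" using Q(1) by auto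
      ultimately have "Q (blinfun_apply (f' (\<gamma> s)) w) = 0" using ortho by auto
      then have "blinfun_apply (f' (\<gamma> s)) w = 0" by (rule ker_Q[OF \<gamma>U[OF s]])
      moreover have "((\<lambda>t. f (\<gamma> t)) has_derivative (\<lambda>h. blinfun_apply (f' (\<gamma> s)) (h *\<^sub>R w))) (at s within {0..\<delta>})"
        using has_derivative_compose[OF d\<gamma> derf[OF sW]] by simp
      ultimately show "((\<lambda>t. f (\<gamma> t)) has_derivative (\<lambda>h. 0)) (at s within {0..\<delta>})"
        by (simp add: blinfun.bilinear_simps)
    qed (use t \<delta> in auto)
    from this[of \<delta>] have "f (\<gamma> \<delta>) = f (\<gamma> 0)" using \<delta> by simp
    moreover have "\<gamma> \<delta> \<in> W" "\<gamma> 0 \<in> W" using \<gamma>U[of \<delta>] \<gamma>U[of 0] U \<delta> by auto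
    ultimately have "\<gamma> \<delta> = \<gamma> 0" using \<open>inj_on f W\<close> by (auto simp: inj_on_def)
    with F\<gamma>[of \<delta>] F\<gamma>[of 0] have "\<delta> *\<^sub>R v = 0" using \<delta> by simp
    with \<delta> \<open>v \<noteq> 0\<close> show False by simp
  qed
  then have "inj (blinfun_apply (f' x0))"
    unfolding linear_injective_0[OF lin] by (auto simp: K_def)
  with x0 show ?thesis by blast
qed

section \<open>Derivatives and nonvanishing sets of polynomial functions\<close>

lemma real_polynomial_function_C1:
  fixes p :: "'a::euclidean_space \<Rightarrow> real"
  assumes "real_polynomial_function p"
  shows "\<exists>p' :: 'a \<Rightarrow> 'a \<Rightarrow>\<^sub>L real.
    (\<forall>x. (p has_derivative blinfun_apply (p' x)) (at x)) \<and> continuous_on UNIV p'"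
  using assms
proof induction
  case (linear f)
  then show ?case
    by (intro exI[of _ "\<lambda>_. Blinfun f"])
      (auto simp: bounded_linear_Blinfun_apply intro: bounded_linear_imp_has_derivative)
next
  case (const c)
  then show ?case
    by (intro exI[of _ "\<lambda>_. 0"]) auto
next
  case (add f g)
  then obtain f' g' :: "'a \<Rightarrow> 'a \<Rightarrow>\<^sub>L real"
    where "\<And>x. (f has_derivative blinfun_apply (f' x)) (at x)" "continuous_on UNIV f'"
      "\<And>x. (g has_derivative blinfun_apply (g' x)) (at x)" "continuous_on UNIV g'" by blast
  then show ?case
    by (intro exI[of _ "\<lambda>x. f' x + g' x"])
      (auto simp: blinfun.bilinear_simps intro!: continuous_intros has_derivative_add)
next
  case (mult f g)
  then obtain f' g' :: "'a \<Rightarrow> 'a \<Rightarrow>\<^sub>L real"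
    where d: "\<And>x. (f has_derivative blinfun_apply (f' x)) (at x)" "continuous_on UNIV f'"
      "\<And>x. (g has_derivative blinfun_apply (g' x)) (at x)" "continuous_on UNIV g'" by blast
  have "continuous_on UNIV f" "continuous_on UNIV g"
    using d(1,3) by (meson continuous_at_imp_continuous_on has_derivative_continuous)+
  then have "continuous_on UNIV (\<lambda>x. f x *\<^sub>R g' x + g x *\<^sub>R f' x)"
    using d by (intro continuous_intros)
  moreover have "((\<lambda>x. f x * g x) has_derivative blinfun_apply (f x *\<^sub>R g' x + g x *\<^sub>R f' x)) (at x)" for x
    using has_derivative_mult[OF d(1) d(3), of x]
    by (rule has_derivative_eq_rhs) (auto simp: blinfun.bilinear_simps mult.commute)
  ultimately show ?case by (intro exI conjI allI)
qed

lemma polynomial_function_C1: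
  fixes p :: "'a::euclidean_space \<Rightarrow> 'b::euclidean_space"
  assumes "polynomial_function p"
  obtains p' :: "'a \<Rightarrow> 'a \<Rightarrow>\<^sub>L 'b"
  where "\<And>x. (p has_derivative blinfun_apply (p' x)) (at x)" "continuous_on UNIV p'"
proof -
  have "\<forall>b\<in>Basis. \<exists>p' :: 'a \<Rightarrow> 'a \<Rightarrow>\<^sub>L real.
      (\<forall>x. ((\<lambda>x. p x \<bullet> b) has_derivative blinfun_apply (p' x)) (at x)) \<and> continuous_on UNIV p'"
    using assms by (auto simp: polynomial_function_iff_Basis_inner intro!: real_polynomial_function_C1)
  then obtain q :: "'b \<Rightarrow> 'a \<Rightarrow> 'a \<Rightarrow>\<^sub>L real" where
    q: "\<And>b x. b \<in> Basis \<Longrightarrow> ((\<lambda>x. p x \<bullet> b) has_derivative blinfun_apply (q b x)) (at x)"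
       "\<And>b. b \<in> Basis \<Longrightarrow> continuous_on UNIV (q b)" by metis
  define p' where "p' x = (\<Sum>b\<in>Basis. blinfun_scaleR_left b o\<^sub>L q b x)" for x
  have app: "blinfun_apply (p' x) = (\<lambda>v. \<Sum>b\<in>Basis. blinfun_apply (q b x) v *\<^sub>R b)" for x
    by (auto simp: p'_def blinfun.sum_left)
  have "(p has_derivative blinfun_apply (p' x)) (at x)" for x
  proof -
    have "((\<lambda>x. \<Sum>b\<in>Basis. (p x \<bullet> b) *\<^sub>R b) has_derivative blinfun_apply (p' x)) (at x)"
      unfolding app by (intro has_derivative_sum has_derivative_scaleR_left q)
    then show ?thesis by (simp add: euclidean_representation)
  qed
  moreover have "continuous_on UNIV p'"
    unfolding p'_def
    by (intro continuous_on_sum bounded_bilinear.continuous_on[OF bounded_bilinear_blinfun_compose]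
        continuous_on_const q)
  ultimately show ?thesis using that by blast
qed

text \<open>On the line from \<open>x\<close> to \<open>a\<close> the function is a univariate
  polynomial that does not vanish at parameter 1. It has finitely many roots, so arbitrarily small
  positive parameters avoid them.\<close>

lemma real_polynomial_function_dense_nonzero:
  fixes p :: "'a::real_normed_vector \<Rightarrow> real"
  assumes p: "real_polynomial_function p" and S: "subspace S" and "a \<in> S" "p a \<noteq> 0"
  shows "S \<subseteq> closure {x \<in> S. p x \<noteq> 0}"
proof
  fix x assume x: "x \<in> S"
  define l where "l t = x + t *\<^sub>R (a - x)" for t :: real
  have lS: "l t \<in> S" for t
    using S x \<open>a \<in> S\<close> by (auto simp: l_def intro!: subspace_add subspace_scale subspace_diff)
  have "polynomial_function l"
    unfolding l_def by (intro polynomial_function_add polynomial_function_const polynomial_function_bounded_linear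
      bounded_linear_scaleR_left)
  then have "real_polynomial_function (p \<circ> l)"
    using p by blast
  then obtain c n where c: "p \<circ> l = (\<lambda>t. \<Sum>i\<le>n. c i * t ^ i)"
    using real_polynomial_function_iff_sum by blast
  have "p (l 1) \<noteq> 0" using \<open>p a \<noteq> 0\<close> by (simp add: l_def)
  then have "\<exists>i\<le>n. c i \<noteq> 0"
    using fun_cong[OF c, of 1] by (auto intro!: sum.neutral)
  then have fin: "finite {t. p (l t) = 0}"
    using c polyfun_finite_roots[of c n] by (simp add: fun_eq_iff)
  have "\<exists>y\<in>{x \<in> S. p x \<noteq> 0}. dist y x < e" if "e > 0" for e
  proof -
    define \<delta> where "\<delta> = e / (norm (a - x) + 1)"
    have "\<delta> > 0" using that by (simp add: \<delta>_def add_nonneg_pos)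
    then have "infinite {0<..<\<delta>}" by (simp add: infinite_Ioo)
    then obtain t where t: "t \<in> {0<..<\<delta>}" "p (l t) \<noteq> 0"
      using fin by (metis (mono_tags, lifting) finite_subset mem_Collect_eq subsetI)
    have "dist (l t) x = t * norm (a - x)" using t by (simp add: l_def dist_norm)
    also have "\<dots> \<le> t * (norm (a - x) + 1)" using t by (auto simp: mult_left_mono)
    also have "\<dots> < \<delta> * (norm (a - x) + 1)"
      using t by (intro mult_strict_right_mono) (auto simp: add_nonneg_pos)
    also have "\<dots> = e"
      using add_nonneg_pos[of "norm (a - x)" 1] by (simp add: \<delta>_def)
    finally show ?thesis using t lS by blast
  qed
  then show "x \<in> closure {x \<in> S. p x \<noteq> 0}" by (simp add: closure_approachable)
qed

text \<open>The open set where \<open>p\<close> is nonzero meets the dense set where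
  \<open>q\<close> is nonzero. This merges generic conditions whose witnesses were found
  separately.\<close>

lemma polynomial_functions_common_nonzero:
  fixes p q :: "'a::euclidean_space \<Rightarrow> real"
  assumes p: "real_polynomial_function p" and q: "real_polynomial_function q" and S: "subspace S"
    and "a \<in> S" "p a \<noteq> 0" "b \<in> S" "q b \<noteq> 0"
  obtains c where "c \<in> S" "p c \<noteq> 0" "q c \<noteq> 0"
proof -
  have "continuous_on UNIV p"
    using p by (simp add: continuous_on_polymonial_function real_polynomial_function_eq)
  then have "open {x. p x \<noteq> 0}"
    by (intro open_Collect_neq) auto
  moreover have "a \<in> closure {x \<in> S. q x \<noteq> 0}"
    using real_polynomial_function_dense_nonzero[OF q S] assms by blast
  ultimately have "{x. p x \<noteq> 0} \<inter> {x \<in> S. q x \<noteq> 0} \<noteq> {}"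
    using \<open>p a \<noteq> 0\<close> open_Int_closure_eq_empty[of "{x. p x \<noteq> 0}"] by blast
  then show thesis using that by blast
qed


subsection \<open>Characteristic polynomials and realizations\<close>

lemma coeff_prod_linear:
  fixes a b :: "'i \<Rightarrow> 'a::comm_ring_1"
  assumes "finite S"
  shows "degree (\<Prod>i\<in>S. [:b i, a i:]) \<le> card S"
    and "coeff (\<Prod>i\<in>S. [:b i, a i:]) (card S) = (\<Prod>i\<in>S. a i)"
proof -
  have "degree (\<Prod>i\<in>S. [:b i, a i:]) \<le> card S \<and> coeff (\<Prod>i\<in>S. [:b i, a i:]) (card S) = (\<Prod>i\<in>S. a i)"
    using assms
  proof induction
    case (insert x S)
    have "degree [:b x, a x:] \<le> 1" by simp
    then have "degree ([:b x, a x:] * (\<Prod>i\<in>S. [:b i, a i:])) \<le> Suc (card S)"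
      using degree_mult_le[of "[:b x, a x:]" "\<Prod>i\<in>S. [:b i, a i:]"] insert.IH by linarith
    moreover have "coeff (\<Prod>i\<in>S. [:b i, a i:]) (Suc (card S)) = 0"
      using insert.IH by (intro coeff_eq_0) auto
    ultimately show ?case
      using insert by (simp add: mult_pCons_left)
  qed auto
  then show "degree (\<Prod>i\<in>S. [:b i, a i:]) \<le> card S"
    and "coeff (\<Prod>i\<in>S. [:b i, a i:]) (card S) = (\<Prod>i\<in>S. a i)" by auto
qed

lemma charpoly_on_alt:
  "charpoly_on S A = (\<Sum>p | p permutes S. of_int (sign p) * (\<Prod>i\<in>S. [:- A $ i $ p i, if i = p i then 1 else 0:]))"
  unfolding charpoly_on_def det_on_def
  by (intro sum.cong arg_cong2[where f = "(*)"] prod.cong refl) auto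

text \<open>The leading coefficient and the zeros above it come from the identity matrix alone. This
  accounts for the coefficients that \<open>double_charpoly\<close> leaves out.\<close>

lemma coeff_charpoly_on_ge:
  fixes A A' :: "real^'n::finite^'n"
  assumes "card S \<le> k"
  shows "coeff (charpoly_on S A) k = coeff (charpoly_on S A') k"
proof -
  have "coeff (of_int (sign p) * (\<Prod>i\<in>S. [:- A $ i $ p i, if i = p i then 1 else 0:])) k =
      of_int (sign p) * (if k = card S then \<Prod>i\<in>S. if i = p i then 1 else 0 else 0)"
    for A :: "real^'n^'n" and p
  proof -
    have "coeff (of_int (sign p) * q) k = of_int (sign p) * coeff q k" for q :: "real poly"
      by (simp add: of_int_poly)
    moreover have "coeff (\<Prod>i\<in>S. [:- A $ i $ p i, if i = p i then 1 else 0:]) k = 0" if "k \<noteq> card S"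
      using coeff_prod_linear(1)[of S "\<lambda>i. - A $ i $ p i" "\<lambda>i. if i = p i then 1 else 0"] that assms
      by (intro coeff_eq_0) auto
    ultimately show ?thesis
      using coeff_prod_linear(2)[of S "\<lambda>i. - A $ i $ p i" "\<lambda>i. if i = p i then 1 else 0"] by simp
  qed
  then show ?thesis
    by (simp add: charpoly_on_alt coeff_sum)
qed

lemma double_charpoly_eq_iff:
  fixes A A' :: "real^'n::finite^'n"
  shows "double_charpoly r A = double_charpoly r A' \<longleftrightarrow>
    charpoly_on UNIV A = charpoly_on UNIV A' \<and> charpoly_on (UNIV - {r}) A = charpoly_on (UNIV - {r}) A'"
proof
  assume eq: "double_charpoly r A = double_charpoly r A'"
  have 1: "\<forall>k\<in>{1..<CARD('n) + 1}. coeff (charpoly_on UNIV A) (CARD('n) - k) = coeff (charpoly_on UNIV A') (CARD('n) - k)"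
    and 2: "\<forall>k\<in>{1..<CARD('n)}. coeff (charpoly_on (UNIV - {r}) A) (CARD('n) - 1 - k) =
      coeff (charpoly_on (UNIV - {r}) A') (CARD('n) - 1 - k)"
    using eq unfolding double_charpoly_def by (auto simp: append_eq_append_conv map_eq_conv)
  have card: "card (UNIV - {r}) = CARD('n) - 1" by simp
  show "charpoly_on UNIV A = charpoly_on UNIV A' \<and> charpoly_on (UNIV - {r}) A = charpoly_on (UNIV - {r}) A'"
  proof (intro conjI poly_eqI)
    fix k
    show "coeff (charpoly_on UNIV A) k = coeff (charpoly_on UNIV A') k"
    proof (cases "k < CARD('n)")
      case True
      \<comment> \<open>The list stores coefficients in reverse: position \<open>k\<close> holds the
        coefficient of index \<open>CARD('n) - k\<close>, so the subtraction has to be inverted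
        within range.\<close>
      then have "CARD('n) - k \<in> {1..<CARD('n) + 1}" "CARD('n) - (CARD('n) - k) = k"
        unfolding atLeastLessThan_iff by linarith+
      then show ?thesis using 1 by metis
    qed (simp add: coeff_charpoly_on_ge)
    show "coeff (charpoly_on (UNIV - {r}) A) k = coeff (charpoly_on (UNIV - {r}) A') k"
    proof (cases "k < CARD('n) - 1")
      case True
      then have "CARD('n) - 1 - k \<in> {1..<CARD('n)}" "CARD('n) - 1 - (CARD('n) - 1 - k) = k"
        unfolding atLeastLessThan_iff by linarith+
      then show ?thesis using 2 by metis
    qed (simp add: coeff_charpoly_on_ge)
  qed
qed (simp add: double_charpoly_def)

lemma poly_charpoly_on:
  "poly (charpoly_on S A) s = det_on S (\<lambda>i j. (mat s - A) $ i $ j)"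
  unfolding charpoly_on_def det_on_def
  by (auto simp: poly_sum poly_prod mat_def intro!: sum.cong prod.cong)

lemma poly_charpoly_on_UNIV: "poly (charpoly_on UNIV A) s = det (mat s - A)"
  unfolding poly_charpoly_on by (rule det_on_UNIV)

text \<open>A permutation that moves \<open>r\<close> picks the entry of column \<open>r\<close> in
  a row other than \<open>r\<close>, which is 0; the remaining ones are the permutations of the
  other vertices. In this form Cramer's rule applies.\<close>

lemma det_on_delete:
  fixes M :: "'n::finite \<Rightarrow> 'n \<Rightarrow> 'a::comm_ring_1"
  shows "det_on (UNIV - {r}) M = det (\<chi> i j. if j = r then axis r 1 $ i else M i j)"
proof -
  let ?N = "\<lambda>i j. if j = r then axis r 1 $ i else M i j"
  have "(\<Sum>p | p permutes (UNIV - {r}). of_int (sign p) * (\<Prod>i\<in>UNIV - {r}. M i (p i))) =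
      (\<Sum>p | p permutes UNIV. of_int (sign p) * (\<Prod>i\<in>UNIV. ?N i (p i)))"
  proof (rule sum.mono_neutral_cong_left)
    show "\<forall>p\<in>{p. p permutes UNIV} - {p. p permutes (UNIV - {r})}.
        of_int (sign p) * (\<Prod>i\<in>UNIV. ?N i (p i)) = 0"
    proof
      fix p :: "'n \<Rightarrow> 'n" assume p: "p \<in> {p. p permutes UNIV} - {p. p permutes (UNIV - {r})}"
      then have bij: "bij p" using permutes_bij by blast
      have "p r \<noteq> r"
      proof
        assume "p r = r"
        then have "p permutes (UNIV - {r})"
          using p by (auto simp: permutes_def)
        with p show False by simp
      qed
      obtain i where i: "p i = r" using bij by (metis bij_pointE)
      then have "i \<noteq> r" using \<open>p r \<noteq> r\<close> by auto
      then have "?N i (p i) = 0" using i by (simp add: axis_def)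
      then have "(\<Prod>i\<in>UNIV. ?N i (p i)) = 0" by (intro prod_zero bexI[of _ i]) auto
      then show "of_int (sign p) * (\<Prod>i\<in>UNIV. ?N i (p i)) = 0" by simp
    qed
    show "of_int (sign p) * (\<Prod>i\<in>UNIV - {r}. M i (p i)) = of_int (sign p) * (\<Prod>i\<in>UNIV. ?N i (p i))"
      if "p \<in> {p. p permutes (UNIV - {r})}" for p
    proof -
      have p: "p permutes (UNIV - {r})" using that by simp
      have "p r = r" using p by (simp add: permutes_def)
      moreover have "p i \<noteq> r" if "i \<noteq> r" for i
        using p that by (metis \<open>p r = r\<close> permutes_inj injD)
      ultimately show ?thesis
        by (subst (2) prod.remove[of _ r]) (auto simp: axis_def intro!: prod.cong)
    qed
  qed (auto intro: permutes_subset)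
  then show ?thesis by (simp add: det_on_def det_def)
qed

text \<open>Cramer's rule for the \<open>r\<close>-th entry of the resolvent applied to the unit
  vector: the transfer function is the quotient of the two characteristic polynomials.\<close>

lemma poly_charpoly_on_delete:
  fixes A :: "real^'n::finite^'n"
  assumes "det (mat s - A) \<noteq> 0" "(mat s - A) *v w = axis r 1"
  shows "poly (charpoly_on (UNIV - {r}) A) s = det (mat s - A) * w $ r"
proof -
  have "w = (\<chi> k. det (\<chi> i j. if j = k then axis r 1 $ i else (mat s - A) $ i $ j) / det (mat s - A))"
    using cramer[OF assms(1)] assms(2) by blast
  then have "w $ r = det (\<chi> i j. if j = r then axis r 1 $ i else (mat s - A) $ i $ j) / det (mat s - A)"
    using arg_cong[of w _ "\<lambda>v. v $ r"] by simp
  then show ?thesis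
    using assms(1) unfolding poly_charpoly_on det_on_delete by simp
qed

section \<open>Krylov vectors, resolvents and Markov parameters\<close>

text \<open>With e the unit vector of \<open>r\<close>, these are the vectors A^k e; their
  \<open>r\<close>-th entries are the Markov parameters of the model.\<close>

definition krylov :: "'n::finite \<Rightarrow> real^'n^'n \<Rightarrow> nat \<Rightarrow> real^'n"
  where "krylov r A k = ((*v) A ^^ k) (axis r 1)"

lemma krylov_0 [simp]: "krylov r A 0 = axis r 1"
  by (simp add: krylov_def)

lemma krylov_Suc: "krylov r A (Suc k) = A *v krylov r A k"
  by (simp add: krylov_def)

text \<open>Powers of \<open>A\<close> move across the inner product one at a time. This is the
  source of the Hankel structure below.\<close>

lemma krylov_transpose_inner:
  "krylov r (transpose A) a \<bullet> krylov r A b = krylov r A (a + b) $ r"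
proof (induction a arbitrary: b)
  case 0
  show ?case by (simp add: inner_axis')
next
  case (Suc a)
  have "krylov r (transpose A) (Suc a) \<bullet> krylov r A b = krylov r (transpose A) a \<bullet> krylov r A (Suc b)"
    by (simp add: krylov_Suc dot_lmul_matrix)
  then show ?case by (simp add: Suc)
qed

lemma bounded_linear_matrix_power: "bounded_linear ((*v) A ^^ k)"
  for A :: "real^'n::finite^'n"
proof (induction k)
  case (Suc k)
  have "bounded_linear (\<lambda>x. A *v ((*v) A ^^ k) x)"
    by (rule bounded_linear_compose[OF matrix_vector_mul_bounded_linear Suc])
  then show ?case by (simp add: o_def)
qed (simp add: id_def)

lemma matrix_diff_ldistrib: "A ** (B - C) = A ** B - A ** C"
  for A :: "'a::ring_1^'n::finite^'m"
  by (simp add: matrix_matrix_mult_def vec_eq_iff right_diff_distrib sum_subtractf)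

lemma matrix_diff_rdistrib: "(A - B) ** C = A ** C - B ** C"
  for A :: "'a::ring_1^'n::finite^'m"
  by (simp add: matrix_matrix_mult_def vec_eq_iff left_diff_distrib sum_subtractf)

lemma matrix_inv_right: "invertible A \<Longrightarrow> A ** matrix_inv A = mat 1"
  and matrix_inv_left: "invertible A \<Longrightarrow> matrix_inv A ** A = mat 1"
  unfolding invertible_def matrix_inv_def by (metis (mono_tags, lifting) someI_ex)+

lemma mat_vector_mult: "mat s *v v = s *\<^sub>R v" for v :: "real^'n::finite"
  by (simp add: mat_def vec_eq_iff matrix_vector_mult_def if_distrib[where f = "\<lambda>x. x * _"] cong: if_cong)

text \<open>Let \<open>K\<close> bound the operator norm of \<open>A\<close>. For s >
  \<open>K\<close> no nonzero vector satisfies A v = s v, and s |w| \<le> 1 + K |w| yields the decay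
  |w| \<le> 1 / (s - K).\<close>

lemma resolvent_exists:
  fixes A :: "real^'n::finite^'n"
  obtains K w where "\<And>s. s > K \<Longrightarrow> det (mat s - A) \<noteq> 0"
    "\<And>s. s > K \<Longrightarrow> (mat s - A) *v w s = axis r 1" "(w \<longlongrightarrow> 0) at_top"
proof -
  obtain K where K: "\<And>v. norm (A *v v) \<le> norm v * K" "K > 0"
    using bounded_linear.pos_bounded[OF matrix_vector_mul_bounded_linear[of A]] by blast
  have inv: "invertible (mat s - A)" if "s > K" for s
  proof -
    have "v = 0" if "(mat s - A) *v v = 0" for v
    proof (rule ccontr)
      assume "v \<noteq> 0"
      have "s *\<^sub>R v = A *v v" using that by (simp add: matrix_vector_mult_diff_rdistrib mat_vector_mult)
      then have "s * norm v \<le> norm v * K"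
        using K(1)[of v] \<open>s > K\<close> K(2) by (metis abs_of_pos norm_scaleR order_less_trans)
      with \<open>v \<noteq> 0\<close> \<open>s > K\<close> show False by simp
    qed
    then show ?thesis by (simp add: invertible_left_inverse matrix_left_invertible_ker)
  qed
  define w where "w s = matrix_inv (mat s - A) *v axis r 1" for s
  have w: "(mat s - A) *v w s = axis r 1" if "s > K" for s
    using matrix_inv_right[OF inv[OF that]] by (simp add: w_def matrix_vector_mul_assoc)
  have "norm (w s) \<le> 1 / (s - K)" if "s > K" for s
  proof -
    have "s *\<^sub>R w s = axis r 1 + A *v w s"
      using w[OF that] by (simp add: matrix_vector_mult_diff_rdistrib mat_vector_mult algebra_simps)
    then have "s * norm (w s) \<le> norm (axis r 1 :: real^'n) + norm (A *v w s)"
      using that K(2) by (metis abs_of_pos norm_scaleR norm_triangle_ineq order_less_trans)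
    also have "\<dots> \<le> 1 + norm (w s) * K" using K(1)[of "w s"] by (simp add: norm_eq_1 inner_axis_axis)
    finally show ?thesis using that by (simp add: field_simps)
  qed
  then have "\<forall>\<^sub>F s in at_top. norm (w s) \<le> 1 / (s - K)"
    using eventually_gt_at_top[of K] by (rule eventually_mono[rotated])
  moreover have "((\<lambda>s. 1 / (s - K)) \<longlongrightarrow> 0) at_top"
    by (intro tendsto_divide_0[OF tendsto_const] filterlim_at_top_imp_at_infinity
        filterlim_tendsto_add_at_top[OF tendsto_const[of "- K"] filterlim_ident, simplified])
  ultimately have "(w \<longlongrightarrow> 0) at_top"
    by (rule Lim_null_comparison)
  then show ?thesis using that[of K w] inv w by (auto simp: invertible_det_nz)
qed

text \<open>Apply A^k to A w = s w - e and read off entry \<open>r\<close>. The recursion extracts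
  the Markov parameters from the transfer function one after the other.\<close>

lemma matrix_power_resolvent:
  fixes A :: "real^'n::finite^'n"
  assumes "(mat s - A) *v w = axis r 1"
  shows "((*v) A ^^ Suc k) w $ r = s * ((*v) A ^^ k) w $ r - krylov r A k $ r"
proof -
  have "A *v w = s *\<^sub>R w - axis r 1"
    using assms by (simp add: matrix_vector_mult_diff_rdistrib mat_vector_mult algebra_simps)
  then have "((*v) A ^^ Suc k) w = ((*v) A ^^ k) (s *\<^sub>R w - axis r 1)"
    by (simp add: funpow_swap1)
  also have "\<dots> = s *\<^sub>R ((*v) A ^^ k) w - krylov r A k"
    using bounded_linear.linear[OF bounded_linear_matrix_power[of k A]]
    by (simp add: linear_diff linear_cmul krylov_def)
  finally show ?thesis by simp
qed

text \<open>Equal characteristic polynomials give equal transfer functions for large s, and the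
  Markov parameters are the coefficients of the expansion of the transfer function at
  infinity.\<close>

lemma charpolys_eq_imp_krylov_eq:
  fixes A A' :: "real^'n::finite^'n"
  assumes "charpoly_on UNIV A = charpoly_on UNIV A'"
    "charpoly_on (UNIV - {r}) A = charpoly_on (UNIV - {r}) A'"
  shows "krylov r A k $ r = krylov r A' k $ r"
proof -
  obtain K w where w: "\<And>s. s > K \<Longrightarrow> det (mat s - A) \<noteq> 0"
      "\<And>s. s > K \<Longrightarrow> (mat s - A) *v w s = axis r 1" "(w \<longlongrightarrow> 0) at_top"
    by (rule resolvent_exists[of A r]) blast
  obtain K' w' where w': "\<And>s. s > K' \<Longrightarrow> det (mat s - A') \<noteq> 0"
      "\<And>s. s > K' \<Longrightarrow> (mat s - A') *v w' s = axis r 1" "(w' \<longlongrightarrow> 0) at_top"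
    by (rule resolvent_exists[of A' r]) blast
  have lim: "((\<lambda>s. ((*v) M ^^ k) (v s) $ r) \<longlongrightarrow> 0) at_top"
    if "(v \<longlongrightarrow> 0) at_top" for M :: "real^'n^'n" and v k
    using bounded_linear.tendsto_zero[OF bounded_linear_compose[OF bounded_linear_vec_nth bounded_linear_matrix_power] that] .
  \<comment> \<open>By the recursion, s times the entry differs from the Markov parameter by the
    entry for the next power, which tends to 0.\<close>
  have lim_krylov: "((\<lambda>s. s * ((*v) M ^^ k) (v s) $ r) \<longlongrightarrow> krylov r M k $ r) at_top"
    if "(v \<longlongrightarrow> 0) at_top" "\<And>s. s > L \<Longrightarrow> (mat s - M) *v v s = axis r 1" for M :: "real^'n^'n" and v k L
  proof -
    have "((\<lambda>s. ((*v) M ^^ Suc k) (v s) $ r + krylov r M k $ r) \<longlongrightarrow> 0 + krylov r M k $ r) at_top"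
      by (intro tendsto_intros lim[OF that(1)])
    moreover have "\<forall>\<^sub>F s in at_top. ((*v) M ^^ Suc k) (v s) $ r + krylov r M k $ r = s * ((*v) M ^^ k) (v s) $ r"
      using eventually_gt_at_top[of L]
      by (rule eventually_mono) (simp add: matrix_power_resolvent[OF that(2)] del: funpow.simps)
    ultimately show ?thesis by (simp add: tendsto_cong)
  qed
  have step: "krylov r A k $ r = krylov r A' k $ r"
    if "\<forall>\<^sub>F s in at_top. ((*v) A ^^ k) (w s) $ r = ((*v) A' ^^ k) (w' s) $ r" for k
  proof (rule tendsto_unique[OF _ lim_krylov[OF w(3) w(2)]])
    have "\<forall>\<^sub>F s in at_top. s * ((*v) A' ^^ k) (w' s) $ r = s * ((*v) A ^^ k) (w s) $ r"
      using that by (rule eventually_mono) simp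
    from tendsto_cong[OF this] lim_krylov[OF w'(3) w'(2)]
    show "((\<lambda>s. s * ((*v) A ^^ k) (w s) $ r) \<longlongrightarrow> krylov r A' k $ r) at_top"
      by blast
  qed auto
  \<comment> \<open>Agreement for \<open>k\<close> yields the \<open>k\<close>-th Markov parameter
    by \<open>step\<close>, and the recursion then turns this into agreement for
    \<open>Suc k\<close>.\<close>
  have "\<forall>\<^sub>F s in at_top. ((*v) A ^^ k) (w s) $ r = ((*v) A' ^^ k) (w' s) $ r" for k
  proof (induction k)
    case 0
    show ?case
      using eventually_gt_at_top[of K] eventually_gt_at_top[of K']
    proof eventually_elim
      case (elim s)
      have "det (mat s - A) = det (mat s - A')"
        using assms(1) by (metis poly_charpoly_on_UNIV)
      then show ?case
        using poly_charpoly_on_delete[OF w(1,2)[OF elim(1)]]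
          poly_charpoly_on_delete[OF w'(1,2)[OF elim(2)]] w(1)[OF elim(1)] assms(2) by simp
    qed
  next
    case (Suc k)
    show ?case
      using eventually_gt_at_top[of K] eventually_gt_at_top[of K'] Suc
      by eventually_elim
        (simp only: matrix_power_resolvent[OF w(2)] matrix_power_resolvent[OF w'(2)] step[OF Suc])
  qed
  then show ?thesis by (rule step)
qed

text \<open>Similarity preserves the determinant of s - A. Since \<open>T\<close> fixes the unit
  vector from both sides, it carries the resolvent solution for \<open>A\<close> to that for
  \<open>A'\<close> without changing its \<open>r\<close>-th entry, so the transfer functions agree
  too.\<close>

lemma similar_imp_charpolys_eq:
  fixes A A' T :: "real^'n::finite^'n"
  assumes T: "invertible T" "T ** A = A' ** T" and col: "T *v axis r 1 = axis r 1"
    and row: "axis r 1 v* T = axis r 1"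
  shows "charpoly_on UNIV A = charpoly_on UNIV A'"
    and "charpoly_on (UNIV - {r}) A = charpoly_on (UNIV - {r}) A'"
proof -
  have mat: "mat s ** M = M ** mat s" for s :: real and M :: "real^'n^'n"
    by (simp add: matrix_matrix_mult_def mat_def vec_eq_iff if_distrib[where f = "\<lambda>x. x * _"]
      if_distrib[where f = "\<lambda>x. _ * x"] cong: if_cong)
  have comm: "T ** (mat s - A) = (mat s - A') ** T" for s
    by (simp add: matrix_diff_ldistrib matrix_diff_rdistrib T(2) mat)
  have det: "det (mat s - A) = det (mat s - A')" for s
    using arg_cong[OF comm[of s], of det] T(1) by (simp add: det_mul invertible_det_nz)
  then show "charpoly_on UNIV A = charpoly_on UNIV A'"
    by (simp add: poly_eq_poly_eq_iff[symmetric] fun_eq_iff poly_charpoly_on_UNIV)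
  obtain K w where w: "\<And>s. s > K \<Longrightarrow> det (mat s - A) \<noteq> 0"
      "\<And>s. s > K \<Longrightarrow> (mat s - A) *v w s = axis r 1"
    by (rule resolvent_exists[of A r]) blast
  let ?Q = "charpoly_on (UNIV - {r}) A" and ?Q' = "charpoly_on (UNIV - {r}) A'"
  have "poly ?Q s = poly ?Q' s" if "s > K" for s
  proof -
    have "(mat s - A') *v (T *v w s) = axis r 1"
      using w(2)[OF that] col by (simp add: matrix_vector_mul_assoc comm[symmetric])
        (simp add: matrix_vector_mul_assoc[symmetric])
    moreover have "(T *v w s) $ r = w s $ r"
      using arg_cong[OF row, of "\<lambda>v. v \<bullet> w s"] by (simp add: dot_lmul_matrix inner_axis')
    ultimately show ?thesis
      using poly_charpoly_on_delete[OF w[OF that]] poly_charpoly_on_delete[of s A' "T *v w s" r]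
        w(1)[OF that] by (simp add: det)
  qed
  \<comment> \<open>Agreement on a half-line suffices for polynomials, so the values where the
    resolvent fails to exist cause no trouble.\<close>
  then have "{K<..} \<subseteq> {s. poly (?Q - ?Q') s = 0}" by auto
  then have "infinite {s. poly (?Q - ?Q') s = 0}"
    using infinite_Ioi infinite_super by blast
  then show "?Q = ?Q'" using poly_roots_finite[of "?Q - ?Q'"] by auto
qed

section \<open>Hankel matrices and uniqueness of minimal realizations\<close>

text \<open>An arbitrary numbering from 0 to n - 1. It lets powers of \<open>A\<close> be indexed by
  vertices, so that Krylov and Hankel matrices are square over the vertex type.\<close>

definition vertex_index :: "'n::finite \<Rightarrow> nat"
  where "vertex_index = (SOME h. bij_betw h UNIV {0..<CARD('n)})"

lemma bij_betw_vertex_index: "bij_betw (vertex_index :: 'n::finite \<Rightarrow> nat) UNIV {0..<CARD('n)}"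
  unfolding vertex_index_def using someI_ex[OF ex_bij_betw_finite_nat[of "UNIV :: 'n set"]] by simp

text \<open>The controllability matrix; formed for \<open>transpose A\<close> and then transposed,
  it is the observability matrix.\<close>

definition krylov_matrix :: "'n::finite \<Rightarrow> real^'n^'n \<Rightarrow> real^'n^'n"
  where "krylov_matrix r A = (\<chi> i j. krylov r A (vertex_index j) $ i)"

text \<open>The Hankel matrix of Markov parameters factors as observability times controllability
  matrix.\<close>

lemma hankel_krylov:
  "(transpose (krylov_matrix r (transpose A)) ** krylov_matrix r A) $ i $ j =
    krylov r A (vertex_index i + vertex_index j) $ r"
  unfolding krylov_transpose_inner[symmetric]
  by (simp add: matrix_matrix_mult_def transpose_def krylov_matrix_def inner_vec_def)

lemma shifted_hankel_krylov:
  "(transpose (krylov_matrix r (transpose A)) ** (A ** krylov_matrix r A)) $ i $ j =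
    krylov r A (Suc (vertex_index i + vertex_index j)) $ r"
proof -
  have "(A ** krylov_matrix r A) $ l $ j = krylov r A (Suc (vertex_index j)) $ l" for l
    by (simp add: krylov_Suc matrix_matrix_mult_def matrix_vector_mult_def krylov_matrix_def)
  then have "(transpose (krylov_matrix r (transpose A)) ** (A ** krylov_matrix r A)) $ i $ j =
      krylov r (transpose A) (vertex_index i) \<bullet> krylov r A (Suc (vertex_index j))"
    unfolding matrix_matrix_mult_def[of "transpose _"] by (simp add: transpose_def krylov_matrix_def inner_vec_def)
  then show ?thesis by (simp add: krylov_transpose_inner)
qed

lemma krylov_matrix_index_0: 
  assumes "vertex_index j = 0"
  shows "krylov_matrix r A *v axis j 1 = axis r 1"
  using assms by (simp add: matrix_vector_mult_basis column_def krylov_matrix_def vec_eq_iff)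

text \<open>The state space isomorphism theorem: the Hankel matrix and its shift determine a
  controllable and observable system up to a change of coordinates, here one compatible with the
  input and output vectors.\<close>

lemma realization_unique:
  fixes A A' :: "real^'n::finite^'n"
  assumes h0: "\<And>(i :: 'n) (j :: 'n). krylov r A (vertex_index i + vertex_index j) $ r =
      krylov r A' (vertex_index i + vertex_index j) $ r"
    and h1: "\<And>(i :: 'n) (j :: 'n). krylov r A (Suc (vertex_index i + vertex_index j)) $ r =
      krylov r A' (Suc (vertex_index i + vertex_index j)) $ r"
    and nz: "det (krylov_matrix r A) \<noteq> 0" "det (krylov_matrix r (transpose A)) \<noteq> 0"
      "det (krylov_matrix r A') \<noteq> 0" "det (krylov_matrix r (transpose A')) \<noteq> 0"
  obtains T where "invertible T" "T ** A = A' ** T" "T *v axis r 1 = axis r 1" "axis r 1 v* T = axis r 1"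
proof -
  let ?R = "krylov_matrix r A" and ?R' = "krylov_matrix r A'"
  let ?O = "transpose (krylov_matrix r (transpose A))" and ?O' = "transpose (krylov_matrix r (transpose A'))"
  have inv: "invertible ?R" "invertible ?R'" "invertible ?O" "invertible ?O'"
    using nz by (auto simp: invertible_det_nz)
  have H0: "?O ** ?R = ?O' ** ?R'"
    by (simp add: vec_eq_iff hankel_krylov h0)
  have H1: "?O ** (A ** ?R) = ?O' ** (A' ** ?R')"
    by (simp add: vec_eq_iff shifted_hankel_krylov h1)
  \<comment> \<open>Chosen to carry one controllability matrix to the other. Equality of the Hankel
    matrices makes the same \<open>T\<close> relate the observability matrices.\<close>
  define T where "T = ?R' ** matrix_inv ?R"
  have TR: "T ** ?R = ?R'"
    using matrix_inv_left[OF inv(1)] by (simp add: T_def matrix_mul_assoc[symmetric])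
  have OT: "?O' ** T = ?O"
    using matrix_inv_right[OF inv(1)] by (simp add: T_def matrix_mul_assoc H0[symmetric])
      (simp add: matrix_mul_assoc[symmetric])
  have cancel_left: "X = Y" if "?O' ** X = ?O' ** Y" for X Y :: "real^'n^'n"
    using arg_cong[OF that, of "(**) (matrix_inv ?O')"] matrix_inv_left[OF inv(4)]
    by (simp add: matrix_mul_assoc)
  have cancel_right: "X = Y" if "X ** ?R = Y ** ?R" for X Y :: "real^'n^'n"
    using arg_cong[OF that, of "\<lambda>Z. Z ** matrix_inv ?R"] matrix_inv_right[OF inv(1)]
    by (simp add: matrix_mul_assoc[symmetric])
  \<comment> \<open>The shifted Hankel identity with the factors \<open>?O' ** T = ?O\<close> and
    \<open>T ** ?R = ?R'\<close> substituted; the outer factors can then be cancelled.\<close>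
  have "?O' ** ((T ** A) ** ?R) = ?O' ** ((A' ** T) ** ?R)"
    using H1 by (simp add: matrix_mul_assoc OT) (simp add: matrix_mul_assoc[symmetric] TR)
  then have "T ** A = A' ** T"
    using cancel_left cancel_right by blast
  moreover have "invertible T"
    using inv(1,2) TR by (metis det_mul invertible_det_nz mult_zero_left)
  \<comment> \<open>The column of index 0 of a Krylov matrix is the unit vector itself, so the
    matrix identities contain the two fixed point equations.\<close>
  moreover obtain j :: 'n where j: "vertex_index j = 0"
    using bij_betw_vertex_index[where 'n = 'n] by (metis atLeastLessThan_iff bij_betw_iff_bijections le0 zero_less_card_finite)
  have "T *v axis r 1 = axis r 1"
    using arg_cong[OF TR, of "\<lambda>M. M *v axis j 1"]
    by (simp add: matrix_vector_mul_assoc[symmetric] krylov_matrix_index_0[OF j])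
  moreover have "axis r 1 v* T = axis r 1"
  proof -
    have "transpose T ** krylov_matrix r (transpose A') = krylov_matrix r (transpose A)"
      using arg_cong[OF OT, of transpose] by (simp add: matrix_transpose_mul)
    from arg_cong[OF this, of "\<lambda>M. M *v axis j 1"] show ?thesis
      by (simp add: matrix_vector_mul_assoc[symmetric] krylov_matrix_index_0[OF j])
  qed
  ultimately show thesis using that by blast
qed


subsection \<open>Generic rank of the matrix B(G)\<close>

text \<open>Full column rank for a matrix whose columns outside \<open>C\<close> are zero padding:
  vectors are tested only if they are supported on \<open>C\<close>.\<close>

definition trivial_kernel_on :: "'c set \<Rightarrow> 'a::comm_ring_1^'c::finite^'m::finite \<Rightarrow> bool"
  where "trivial_kernel_on C M \<longleftrightarrow> (\<forall>x. (\<forall>j. j \<notin> C \<longrightarrow> x $ j = 0) \<and> M *v x = 0 \<longrightarrow> x = 0)"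

text \<open>An injective linear map on the coordinate subspace of \<open>C\<close> has a linear left
  inverse. As a matrix identity this can be specialized and cleared of denominators.\<close>

lemma trivial_kernel_on_left_inverse:
  fixes M :: "'a::field^'c::finite^'m::finite"
  assumes triv: "trivial_kernel_on C M" and zero: "\<And>i j. j \<notin> C \<Longrightarrow> M $ i $ j = 0"
  obtains D where "D ** M = (\<chi> i j. if i = j \<and> j \<in> C then 1 else 0)"
proof -
  define V where "V = {x :: 'a^'c. \<forall>j. j \<notin> C \<longrightarrow> x $ j = 0}"
  have V: "vec.subspace V"
    unfolding V_def vec.subspace_def by simp
  have "inj_on ((*v) M) V"
  proof (rule inj_onI)
    fix x y assume "x \<in> V" "y \<in> V" "M *v x = M *v y"
    then have "x - y = 0"
      using spec[OF triv[unfolded trivial_kernel_on_def], of "x - y"]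
      by (simp add: V_def matrix_vector_mult_diff_distrib)
    then show "x = y" by simp
  qed
  then obtain g where g: "Vector_Spaces.linear (*s) (*s) g" "\<And>v. v \<in> V \<Longrightarrow> g (M *v v) = v"
    using vec.linear_exists_left_inverse_on[OF matrix_vector_mul_linear_gen V] by blast
  have app: "matrix g *v v = g v" for v
    using matrix_works[OF g(1)] by simp
  have "(matrix g ** M) $ i $ j = (if i = j \<and> j \<in> C then 1 else 0)" for i j
  proof -
    have "(matrix g ** M) $ i $ j = ((matrix g ** M) *v axis j 1) $ i"
      by (simp add: matrix_vector_mult_def axis_def if_distrib[where f = "\<lambda>x. _ * x"] cong: if_cong)
    also have "\<dots> = g (M *v axis j 1) $ i"
      by (simp add: matrix_vector_mul_assoc[symmetric] app)
    also have "\<dots> = (if i = j \<and> j \<in> C then 1 else 0)"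
    proof (cases "j \<in> C")
      case True
      then have "axis j 1 \<in> V" by (auto simp: V_def axis_def)
      then show ?thesis using True by (auto simp: g(2) axis_def)
    next
      case False
      then have "M *v axis j 1 = 0"
        by (auto simp: vec_eq_iff matrix_vector_mult_def axis_def zero intro!: sum.neutral)
      then show ?thesis using False app[of 0] by (simp add: matrix_vector_mult_0_right)
    qed
    finally show ?thesis .
  qed
  then show thesis using that[of "matrix g"] by (simp add: vec_eq_iff)
qed

text \<open>The row space lies in the span of the unit vectors of \<open>C\<close>, and the rank is
  \<open>card C\<close> exactly if it fills that span. Full span kills kernel vectors entry by
  entry; a left inverse writes the unit vectors as combinations of rows.\<close>

lemma rank_eq_card_iff_trivial_kernel_on:
  fixes M :: "'a::field^'c::finite^'m::finite"
  assumes zero: "\<And>i j. j \<notin> C \<Longrightarrow> M $ i $ j = 0"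
  shows "rank M = card C \<longleftrightarrow> trivial_kernel_on C M"
proof -
  define B :: "('a^'c) set" where "B = (\<lambda>j. axis j 1) ` C"
  have "inj_on (\<lambda>j. axis j 1 :: 'a^'c) C"
    by (auto simp: inj_on_def axis_eq_axis)
  then have cardB: "card B = card C" by (simp add: B_def card_image)
  have "B \<subseteq> cart_basis" by (auto simp: B_def cart_basis_def)
  then have indB: "vec.independent B"
    using vec.independent_mono[OF independent_cart_basis] by blast
  have dimB: "vec.dim (vec.span B) = card C"
    using vec.dim_span_eq_card_independent[OF indB] cardB by simp
  have rowsB: "rows M \<subseteq> vec.span B"
  proof
    fix v assume "v \<in> rows M"
    then obtain i where v: "v = row i M" by (auto simp: rows_def)
    have "v = (\<Sum>j\<in>C. M $ i $ j *s axis j 1)"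
      using zero by (auto simp: vec_eq_iff v row_def axis_def if_distrib[where f = "\<lambda>x. _ * x"] cong: if_cong)
    also have "\<dots> \<in> vec.span B"
      by (intro vec.span_sum vec.span_scale vec.span_base) (auto simp: B_def)
    finally show "v \<in> vec.span B" .
  qed
  then have sub: "vec.span (rows M) \<subseteq> vec.span B"
    by (simp add: vec.span_minimal)
  show ?thesis
  proof
    assume "rank M = card C"
    then have "vec.dim (vec.span (rows M)) = vec.dim (vec.span B)"
      unfolding dimB by (simp add: row_rank_def_gen)
    then have span: "vec.span (rows M) = vec.span B"
      using vec.subspace_dim_equal[OF vec.subspace_span vec.subspace_span sub] by simp
    show "trivial_kernel_on C M"
      unfolding trivial_kernel_on_def
    proof (intro allI impI)
      fix x assume x: "(\<forall>j. j \<notin> C \<longrightarrow> x $ j = 0) \<and> M *v x = 0"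
      have "(\<Sum>j\<in>UNIV. v $ j * x $ j) = 0" if "v \<in> vec.span (rows M)" for v
        using that
      proof (induction rule: vec.span_induct)
        case base
        show ?case
          unfolding vec.subspace_def
          by (auto simp: distrib_right sum.distrib mult.assoc sum_distrib_left[symmetric])
      next
        case (step v)
        then obtain i where "v = row i M" by (auto simp: rows_def)
        moreover have "(M *v x) $ i = 0" using x by simp
        ultimately show ?case by (simp add: row_def matrix_vector_mult_def)
      qed
      moreover have "axis j 1 \<in> vec.span (rows M)" if "j \<in> C" for j
        using that unfolding span by (intro vec.span_base) (auto simp: B_def)
      ultimately have "(\<Sum>i\<in>UNIV. axis j 1 $ i * x $ i) = 0" if "j \<in> C" for j
        using that by blast
      then have "x $ j = 0" if "j \<in> C" for j
        using that by (simp add: axis_def if_distrib[where f = "\<lambda>x. x * _"] cong: if_cong)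
      with x show "x = 0" by (auto simp: vec_eq_iff)
    qed
  next
    assume "trivial_kernel_on C M"
    then obtain D where D: "D ** M = (\<chi> i j. if i = j \<and> j \<in> C then 1 else 0)"
      using trivial_kernel_on_left_inverse zero by blast
    have "axis j 1 \<in> vec.span (rows M)" if "j \<in> C" for j
    proof -
      have "axis j 1 = (\<Sum>i\<in>UNIV. D $ j $ i *s row i M)"
      proof -
        have "axis j 1 $ l = (D ** M) $ j $ l" for l
          using that by (auto simp: D axis_def)
        then show ?thesis by (simp add: vec_eq_iff matrix_matrix_mult_def row_def)
      qed
      also have "\<dots> \<in> vec.span (rows M)"
        by (intro vec.span_sum vec.span_scale vec.span_base) (auto simp: rows_def)
      finally show ?thesis .
    qed
    then have "vec.span B \<subseteq> vec.span (rows M)"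
      by (intro vec.span_minimal) (auto simp: B_def)
    with sub show "rank M = card C"
      by (metis dimB row_rank_def_gen subset_antisym vec.dim_span)
  qed
qed

lemma trivial_kernel_on_if_left_multiple:
  fixes M :: "'a::idom^'c::finite^'m::finite"
  assumes "D ** M = (\<chi> i j. if i = j \<and> j \<in> C then q else 0)" "q \<noteq> 0"
  shows "trivial_kernel_on C M"
  unfolding trivial_kernel_on_def
proof (intro allI impI)
  fix x assume x: "(\<forall>j. j \<notin> C \<longrightarrow> x $ j = 0) \<and> M *v x = 0"
  have "q * x $ j = 0" if "j \<in> C" for j
  proof -
    have "(D ** M) *v x = 0" using x by (simp add: matrix_vector_mul_assoc[symmetric])
    then have "((D ** M) *v x) $ j = 0" by simp
    moreover have "(\<Sum>l\<in>UNIV. (if j = l \<and> l \<in> C then q else 0) * x $ l) = (\<Sum>l\<in>UNIV. if l = j then q * x $ l else 0)"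
      using that by (intro sum.cong) auto
    ultimately show ?thesis by (simp add: assms matrix_vector_mult_def)
  qed
  with x \<open>q \<noteq> 0\<close> show "x = 0" by (auto simp: vec_eq_iff)
qed

text \<open>Adding the projection onto the padding coordinates yields a square matrix that acts on
  vectors supported on \<open>C\<close> as \<open>D ** M\<close>. Full column rank is thereby
  certified by one determinant, a polynomial in the entries of \<open>M\<close>.\<close>

lemma trivial_kernel_on_if_det_nz:
  fixes M :: "'a::field^'c::finite^'m::finite"
  assumes "det (D ** M + (\<chi> i j. if i = j \<and> j \<notin> C then 1 else 0)) \<noteq> 0"
  shows "trivial_kernel_on C M"
  unfolding trivial_kernel_on_def
proof (intro allI impI)
  fix x assume x: "(\<forall>j. j \<notin> C \<longrightarrow> x $ j = 0) \<and> M *v x = 0"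
  let ?N = "D ** M + (\<chi> i j. if i = j \<and> j \<notin> C then 1 else 0)"
  have "(\<chi> i j. if i = j \<and> j \<notin> C then 1 else 0) *v x = 0"
    using x by (auto simp: vec_eq_iff matrix_vector_mult_def intro!: sum.neutral)
  then have N: "?N *v x = 0"
    using x by (simp add: matrix_vector_mult_add_rdistrib matrix_vector_mul_assoc[symmetric])
  have "invertible ?N" using assms by (simp only: invertible_det_nz) simp
  then obtain N' where N': "N' ** ?N = mat 1" unfolding invertible_def by blast
  have "x = (N' ** ?N) *v x" by (simp only: N' matrix_vector_mul_lid)
  also have "\<dots> = 0" by (simp only: matrix_vector_mul_assoc[symmetric] N matrix_vector_mult_0_right)
  finally show "x = 0" .
qed

section \<open>Evaluation of multivariate polynomials at real points\<close>

definition monomial_eval :: "(nat \<Rightarrow> real) \<Rightarrow> (nat \<Rightarrow>\<^sub>0 nat) \<Rightarrow> real"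
  where "monomial_eval \<sigma> m = (\<Prod>i\<in>Poly_Mapping.keys m. \<sigma> i ^ Poly_Mapping.lookup m i)"

definition mpoly_eval :: "(nat \<Rightarrow> real) \<Rightarrow> ((nat \<Rightarrow>\<^sub>0 nat) \<Rightarrow>\<^sub>0 real) \<Rightarrow> real"
  where "mpoly_eval \<sigma> p = (\<Sum>m\<in>Poly_Mapping.keys p. Poly_Mapping.lookup p m * monomial_eval \<sigma> m)"

lemma monomial_eval_superset:
  assumes "finite K" "Poly_Mapping.keys m \<subseteq> K"
  shows "monomial_eval \<sigma> m = (\<Prod>i\<in>K. \<sigma> i ^ Poly_Mapping.lookup m i)"
  unfolding monomial_eval_def using assms
  by (intro prod.mono_neutral_left) (auto simp: in_keys_iff)

lemma monomial_eval_add: "monomial_eval \<sigma> (m + m') = monomial_eval \<sigma> m * monomial_eval \<sigma> m'"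
proof -
  let ?K = "Poly_Mapping.keys m \<union> Poly_Mapping.keys m'"
  have "Poly_Mapping.keys (m + m') \<subseteq> ?K" by (rule keys_add)
  then have "monomial_eval \<sigma> (m + m') = (\<Prod>i\<in>?K. \<sigma> i ^ Poly_Mapping.lookup (m + m') i)"
    by (intro monomial_eval_superset) auto
  also have "\<dots> = monomial_eval \<sigma> m * monomial_eval \<sigma> m'"
    by (simp add: lookup_add power_add prod.distrib monomial_eval_superset[of ?K])
  finally show ?thesis .
qed

lemma mpoly_eval_add: "mpoly_eval \<sigma> (p + q) = mpoly_eval \<sigma> p + mpoly_eval \<sigma> q"
  unfolding mpoly_eval_def
  by (rule setsum_keys_plus_distrib) (auto simp: distrib_right)

lemma mpoly_eval_0 [simp]: "mpoly_eval \<sigma> 0 = 0"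
  by (simp add: mpoly_eval_def)

lemma mpoly_eval_sum: "mpoly_eval \<sigma> (\<Sum>i\<in>I. f i) = (\<Sum>i\<in>I. mpoly_eval \<sigma> (f i))"
  by (induction I rule: infinite_finite_induct) (auto simp: mpoly_eval_add)

lemma mpoly_eval_uminus: "mpoly_eval \<sigma> (- p) = - mpoly_eval \<sigma> p"
  using mpoly_eval_add[of \<sigma> p "- p"] by simp

lemma mpoly_eval_diff: "mpoly_eval \<sigma> (p - q) = mpoly_eval \<sigma> p - mpoly_eval \<sigma> q"
  using mpoly_eval_add[of \<sigma> p "- q"] by (simp add: mpoly_eval_uminus)

lemma mpoly_eval_single: "mpoly_eval \<sigma> (Poly_Mapping.single m c) = c * monomial_eval \<sigma> m"
  by (cases "c = 0") (simp_all add: mpoly_eval_def)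

lemma sum_single_lookup:
  fixes p :: "'k \<Rightarrow>\<^sub>0 'v::comm_monoid_add"
  shows "(\<Sum>k\<in>Poly_Mapping.keys p. Poly_Mapping.single k (Poly_Mapping.lookup p k)) = p"
proof (rule poly_mapping_eqI)
  fix k
  have "Poly_Mapping.lookup (\<Sum>l\<in>Poly_Mapping.keys p. Poly_Mapping.single l (Poly_Mapping.lookup p l)) k =
      (\<Sum>l\<in>Poly_Mapping.keys p. if l = k then Poly_Mapping.lookup p k else 0)"
    by (auto simp: lookup_sum lookup_single when_def intro!: sum.cong)
  then show "Poly_Mapping.lookup (\<Sum>l\<in>Poly_Mapping.keys p. Poly_Mapping.single l (Poly_Mapping.lookup p l)) k =
      Poly_Mapping.lookup p k"
    by (simp add: in_keys_iff)
qed

lemma mpoly_eval_mult: "mpoly_eval \<sigma> (p * q) = mpoly_eval \<sigma> p * mpoly_eval \<sigma> q"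
proof -
  let ?s = "\<lambda>p k. Poly_Mapping.single k (Poly_Mapping.lookup p k) :: (nat \<Rightarrow>\<^sub>0 nat) \<Rightarrow>\<^sub>0 real"
  have "p * q = (\<Sum>k\<in>Poly_Mapping.keys p. ?s p k) * (\<Sum>l\<in>Poly_Mapping.keys q. ?s q l)"
    by (simp only: sum_single_lookup)
  also have "\<dots> = (\<Sum>k\<in>Poly_Mapping.keys p. \<Sum>l\<in>Poly_Mapping.keys q.
      Poly_Mapping.single (k + l) (Poly_Mapping.lookup p k * Poly_Mapping.lookup q l))"
    by (simp add: sum_product mult_single)
  finally have "mpoly_eval \<sigma> (p * q) = (\<Sum>k\<in>Poly_Mapping.keys p. \<Sum>l\<in>Poly_Mapping.keys q.
      (Poly_Mapping.lookup p k * monomial_eval \<sigma> k) * (Poly_Mapping.lookup q l * monomial_eval \<sigma> l))"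
    by (simp only: mpoly_eval_sum mpoly_eval_single monomial_eval_add mult_ac)
  then show ?thesis by (simp only: mpoly_eval_def sum_product)
qed

lemma mpoly_eval_const: "mpoly_eval \<sigma> (Poly_Mapping.single 0 c) = c"
  by (simp add: mpoly_eval_single monomial_eval_def)

lemma mpoly_eval_1 [simp]: "mpoly_eval \<sigma> 1 = 1"
  using mpoly_eval_const[of \<sigma> 1] by simp

lemma mpoly_eval_of_int: "mpoly_eval \<sigma> (of_int k) = of_int k"
  using mpoly_eval_const[of \<sigma> "of_int k"] by (simp add: single_of_int)

lemma mpoly_eval_prod: "mpoly_eval \<sigma> (\<Prod>i\<in>I. f i) = (\<Prod>i\<in>I. mpoly_eval \<sigma> (f i))"
  by (induction I rule: infinite_finite_induct) (auto simp: mpoly_eval_mult)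

lemma mpoly_eval_var:
  "mpoly_eval \<sigma> (Poly_Mapping.single (Poly_Mapping.single i 1) 1) = \<sigma> i"
  by (simp add: mpoly_eval_single monomial_eval_def)

lemma base_expansion_less:
  fixes a :: "nat \<Rightarrow> nat"
  assumes "\<And>i. i < K \<Longrightarrow> a i < N"
  shows "(\<Sum>i<K. a i * N ^ i) < N ^ K"
  using assms
proof (induction K)
  case (Suc K)
  have "(\<Sum>i<Suc K. a i * N ^ i) < N ^ K + a K * N ^ K"
    using Suc by simp
  also have "\<dots> = Suc (a K) * N ^ K" by simp
  also have "\<dots> \<le> N * N ^ K" using Suc.prems[of K] by (intro mult_right_mono) auto
  finally show ?case by simp
qed simp

text \<open>Division by \<open>N ^ K\<close> isolates the top digit. Uniqueness of digits is what
  keeps distinct monomials distinct under Kronecker substitution.\<close>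

lemma base_expansion_unique:
  fixes a b :: "nat \<Rightarrow> nat"
  assumes "\<And>i. i < K \<Longrightarrow> a i < N" "\<And>i. i < K \<Longrightarrow> b i < N"
    "(\<Sum>i<K. a i * N ^ i) = (\<Sum>i<K. b i * N ^ i)" "i < K"
  shows "a i = b i"
  using assms
proof (induction K)
  case (Suc K)
  have a: "(\<Sum>i<K. a i * N ^ i) < N ^ K" and b: "(\<Sum>i<K. b i * N ^ i) < N ^ K"
    using Suc.prems by (auto intro!: base_expansion_less)
  have eq: "(\<Sum>i<K. a i * N ^ i) + a K * N ^ K = (\<Sum>i<K. b i * N ^ i) + b K * N ^ K"
    using Suc.prems(3) by simp
  have "a K = b K"
    using arg_cong[OF eq, of "\<lambda>x. x div N ^ K"] a b Suc.prems(1)[of K] by (simp add: div_add1_eq split: if_splits)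
  moreover from this have "(\<Sum>i<K. a i * N ^ i) = (\<Sum>i<K. b i * N ^ i)"
    using eq by simp
  ultimately show ?case
    using Suc by (metis less_Suc_eq)
qed simp

text \<open>Kronecker substitution \<open>x\<^sub>i \<mapsto> t\<^bsup>N^i\<^esup>\<close> with \<open>N\<close> larger than every exponent.\<close>

lemma mpoly_eval_nonzero:
  assumes "p \<noteq> 0"
  obtains \<sigma> where "mpoly_eval \<sigma> p \<noteq> 0"
proof -
  let ?M = "Poly_Mapping.keys p"
  define N where "N = Suc (\<Sum>m\<in>?M. \<Sum>i\<in>Poly_Mapping.keys m. Poly_Mapping.lookup m i)"
  define K where "K = Suc (\<Sum>m\<in>?M. \<Sum>i\<in>Poly_Mapping.keys m. i)"
  have N: "Poly_Mapping.lookup m i < N" if "m \<in> ?M" for m i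
  proof (cases "i \<in> Poly_Mapping.keys m")
    case True
    have "Poly_Mapping.lookup m i \<le> (\<Sum>i\<in>Poly_Mapping.keys m. Poly_Mapping.lookup m i)"
      by (rule member_le_sum[OF True]) auto
    also have "\<dots> \<le> (\<Sum>m\<in>?M. \<Sum>i\<in>Poly_Mapping.keys m. Poly_Mapping.lookup m i)"
      by (rule member_le_sum[OF that]) auto
    finally show ?thesis by (simp add: N_def)
  qed (simp add: in_keys_iff N_def)
  have K: "i < K" if "m \<in> ?M" "i \<in> Poly_Mapping.keys m" for m i
  proof -
    have "i \<le> (\<Sum>i\<in>Poly_Mapping.keys m. i)"
      by (rule member_le_sum[OF that(2), of "\<lambda>i. i"]) auto
    also have "\<dots> \<le> (\<Sum>m\<in>?M. \<Sum>i\<in>Poly_Mapping.keys m. i)"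
      by (rule member_le_sum[OF that(1)]) auto
    finally show ?thesis by (simp add: K_def)
  qed
  define e where "e m = (\<Sum>i<K. Poly_Mapping.lookup m i * N ^ i)" for m
  have inj: "m = m'" if "m \<in> ?M" "m' \<in> ?M" "e m = e m'" for m m'
  proof (rule poly_mapping_eqI)
    fix i
    show "Poly_Mapping.lookup m i = Poly_Mapping.lookup m' i"
    proof (cases "i < K")
      case True
      show ?thesis
        by (rule base_expansion_unique[OF N[OF that(1)] N[OF that(2)] that(3)[unfolded e_def] True])
    next
      case False
      then have "i \<notin> Poly_Mapping.keys m" "i \<notin> Poly_Mapping.keys m'"
        using K that by blast+
      then show ?thesis by (simp add: in_keys_iff)
    qed
  qed
  define P where "P = (\<Sum>m\<in>?M. monom (Poly_Mapping.lookup p m) (e m))"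
  obtain m0 where m0: "m0 \<in> ?M" using assms
    by (metis lookup_not_eq_zero_eq_in_keys lookup_zero poly_mapping_eqI)
  have "coeff P (e m0) = (\<Sum>m\<in>?M. if m = m0 then Poly_Mapping.lookup p m else 0)"
    unfolding P_def coeff_sum using inj[OF _ m0] by (intro sum.cong refl) auto
  then have "coeff P (e m0) \<noteq> 0" using m0 by (simp add: in_keys_iff)
  then have "P \<noteq> 0" by auto
  then obtain t where t: "poly P t \<noteq> 0" using poly_all_0_iff_0 by blast
  have "monomial_eval (\<lambda>i. t ^ (N ^ i)) m = t ^ e m" if "m \<in> ?M" for m
  proof -
    have "monomial_eval (\<lambda>i. t ^ (N ^ i)) m = (\<Prod>i<K. (t ^ (N ^ i)) ^ Poly_Mapping.lookup m i)"
      using K that by (intro monomial_eval_superset) auto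
    then show ?thesis
      by (simp add: e_def power_sum power_mult[symmetric] mult.commute)
  qed
  then have "mpoly_eval (\<lambda>i. t ^ (N ^ i)) p = poly P t"
    by (simp add: mpoly_eval_def P_def poly_sum poly_monom)
  with t that show thesis by metis
qed

section \<open>Specialization of symbolic matrices\<close>

lemma common_denominator:
  fixes S :: "'a::idom fract set"
  assumes "finite S"
  obtains q where "q \<noteq> 0" "\<And>x. x \<in> S \<Longrightarrow> \<exists>p. to_fract q * x = to_fract p"
proof -
  have "\<exists>q. q \<noteq> 0 \<and> (\<forall>x\<in>S. \<exists>p. to_fract q * x = to_fract p)"
    using assms
  proof induction
    case empty
    show ?case by (intro exI[of _ 1]) simp
  next
    case (insert y S)
    then obtain q where q: "q \<noteq> 0" "\<forall>x\<in>S. \<exists>p. to_fract q * x = to_fract p" by blast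
    obtain a b where y: "y = Fract a b" "b \<noteq> 0" by (cases y) auto
    have "to_fract (q * b) * y = to_fract (q * a)"
      using y by (simp add: to_fract_def eq_fract)
    moreover have "\<exists>p. to_fract (q * b) * x = to_fract p" if x: "x \<in> S" for x
    proof -
      obtain p where "to_fract q * x = to_fract p" using q(2)[THEN bspec, OF x] ..
      then have "to_fract (q * b) * x = to_fract (p * b)"
        by (metis mult.assoc mult.commute to_fract_mult)
      then show ?thesis by blast
    qed
    ultimately show ?case
      using q(1) y(2) by (intro exI[of _ "q * b"]) (auto simp del: to_fract_mult)
  qed
  then show thesis using that by blast
qed

lemma det_hom:
  fixes h :: "'a::comm_ring_1 \<Rightarrow> 'b::comm_ring_1" and M :: "'a^'n::finite^'n"
  assumes "\<And>I :: ('n \<Rightarrow> 'n) set. \<And>f. h (sum f I) = (\<Sum>i\<in>I. h (f i))"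
    "\<And>I :: 'n set. \<And>f. h (prod f I) = (\<Prod>i\<in>I. h (f i))"
    "\<And>x y. h (x * y) = h x * h y" "\<And>k. h (of_int k) = of_int k"
  shows "h (det M) = det (\<chi> i j. h (M $ i $ j))"
  by (simp add: det_def assms)

text \<open>The entries use only zero, negation and differences, so an additive map suffices; it is
  applied to evaluation and to the embedding into the fraction field.\<close>

lemma B_matrix_hom:
  assumes "h 0 = 0" "\<And>x y. h (x - y) = h x - h y" "\<And>x. h (- x) = - h x"
  shows "h (B_matrix E r a $ kl $ ij) = B_matrix E r (\<lambda>i j. h (a i j)) $ kl $ ij"
  by (auto simp: B_matrix_def B_entry_def assms split: prod.splits)

lemma B_matrix_zero_column: "ij \<notin> B_cols r \<Longrightarrow> B_matrix E r a $ kl $ ij = 0"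
  by (simp add: B_matrix_def)

lemma to_fract_prod: "to_fract (prod f I) = (\<Prod>i\<in>I. to_fract (f i))"
  by (induction I rule: infinite_finite_induct) auto

lemma to_fract_of_nat: "to_fract (of_nat k) = of_nat k"
  by (induction k) auto

lemma to_fract_of_int: "to_fract (of_int k) = of_int k"
  by (cases k) (auto simp: to_fract_of_nat)

text \<open>From left to right, a symbolic left inverse is cleared of denominators and evaluated
  where the denominator is nonzero. Conversely, a real left inverse gives a polynomial determinant
  that takes the value 1 at one point and hence is nonzero.\<close>

lemma symbolic_trivial_kernel_iff:
  fixes E :: "('n::finite \<times> 'n) set"
  shows "trivial_kernel_on (B_cols r) (B_matrix E r symbolic_param) \<longleftrightarrow>
    (\<exists>a :: 'n \<Rightarrow> 'n \<Rightarrow> real. trivial_kernel_on (B_cols r) (B_matrix E r a))" (is "?L \<longleftrightarrow> ?R")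
proof -
  define X :: "'n \<Rightarrow> 'n \<Rightarrow> (nat \<Rightarrow>\<^sub>0 nat) \<Rightarrow>\<^sub>0 real"
    where "X i j = Poly_Mapping.single (Poly_Mapping.single (to_nat (i, j)) 1) 1" for i j
  let ?B = "B_matrix E r X"
  have "symbolic_param = (\<lambda>i j. to_fract (X i j))"
    by (simp add: fun_eq_iff symbolic_param_def X_def to_fract_def)
  then have sym: "B_matrix E r symbolic_param $ kl $ ij = to_fract (?B $ kl $ ij)" for kl ij
    using B_matrix_hom[of to_fract E r X kl ij] by simp
  have ev: "mpoly_eval \<sigma> (?B $ kl $ ij) = B_matrix E r (\<lambda>i j. \<sigma> (to_nat (i, j))) $ kl $ ij" for \<sigma> kl ij
    using B_matrix_hom[of "mpoly_eval \<sigma>" E r X kl ij]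
    unfolding mpoly_eval_0 mpoly_eval_diff mpoly_eval_uminus X_def mpoly_eval_var by simp
  show ?thesis
  proof
    assume ?L
    then obtain D where D: "D ** B_matrix E r symbolic_param = (\<chi> i j. if i = j \<and> j \<in> B_cols r then 1 else 0)"
      using trivial_kernel_on_left_inverse B_matrix_zero_column by blast
    have "finite (range (\<lambda>(i, j). D $ i $ j))" by simp
    then obtain q where q: "q \<noteq> 0" "\<And>x. x \<in> range (\<lambda>(i, j). D $ i $ j) \<Longrightarrow> \<exists>p. to_fract q * x = to_fract p"
      by (rule common_denominator) blast
    have "\<forall>i j. \<exists>p. to_fract q * D $ i $ j = to_fract p"
      using q(2) by (metis case_prod_conv rangeI)
    then obtain D' where D': "\<And>i j. to_fract q * D $ i $ j = to_fract (D' i j)" by metis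
    have D'B: "(\<Sum>k\<in>UNIV. D' i k * ?B $ k $ j) = (if i = j \<and> j \<in> B_cols r then q else 0)" for i j
    proof -
      have "to_fract (\<Sum>k\<in>UNIV. D' i k * ?B $ k $ j) = to_fract q * (D ** B_matrix E r symbolic_param) $ i $ j"
        by (simp add: to_fract_sum D'[symmetric] sym matrix_matrix_mult_def sum_distrib_left mult.assoc)
      also have "\<dots> = to_fract (if i = j \<and> j \<in> B_cols r then q else 0)"
        by (simp add: D)
      finally show ?thesis by (simp only: to_fract_eq_iff)
    qed
    obtain \<sigma> where \<sigma>: "mpoly_eval \<sigma> q \<noteq> 0" using mpoly_eval_nonzero[OF q(1)] .
    have "(\<chi> i j. mpoly_eval \<sigma> (D' i j)) ** B_matrix E r (\<lambda>i j. \<sigma> (to_nat (i, j))) =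
        (\<chi> i j. if i = j \<and> j \<in> B_cols r then mpoly_eval \<sigma> q else 0)"
    proof -
      have "(\<Sum>k\<in>UNIV. mpoly_eval \<sigma> (D' i k) * B_matrix E r (\<lambda>i j. \<sigma> (to_nat (i, j))) $ k $ j) =
          mpoly_eval \<sigma> (\<Sum>k\<in>UNIV. D' i k * ?B $ k $ j)" for i j
        by (simp add: mpoly_eval_sum mpoly_eval_mult ev)
      then show ?thesis by (simp add: vec_eq_iff matrix_matrix_mult_def D'B)
    qed
    from trivial_kernel_on_if_left_multiple[OF this \<sigma>] show ?R by blast
  next
    assume ?R
    then obtain a :: "'n \<Rightarrow> 'n \<Rightarrow> real" where "trivial_kernel_on (B_cols r) (B_matrix E r a)" by blast
    then obtain D where D: "D ** B_matrix E r a = (\<chi> i j. if i = j \<and> j \<in> B_cols r then 1 else 0)"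
      using trivial_kernel_on_left_inverse B_matrix_zero_column by blast
    \<comment> \<open>The assignment that gives the indeterminate numbered
      \<open>to_nat (i, j)\<close> the value \<open>a i j\<close>.\<close>
    define \<sigma> where "\<sigma> k = (case from_nat k of (i, j) \<Rightarrow> a i j)" for k
    have \<sigma>: "(\<lambda>i j. \<sigma> (to_nat (i, j))) = a" by (simp add: \<sigma>_def fun_eq_iff)
    \<comment> \<open>The real left inverse enters as a matrix of constant polynomials, so that
      \<open>N\<close> evaluates to the identity matrix at \<open>\<sigma>\<close>.\<close>
    define N where "N = (\<chi> i j. (\<Sum>k\<in>UNIV. Poly_Mapping.single 0 (D $ i $ k) * ?B $ k $ j) +
        (if i = j \<and> j \<notin> B_cols r then 1 else 0))"
    have "mpoly_eval \<sigma> (N $ i $ j) = mat 1 $ i $ j" for i j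
    proof -
      have "mpoly_eval \<sigma> (N $ i $ j) = (D ** B_matrix E r a) $ i $ j + (if i = j \<and> j \<notin> B_cols r then 1 else 0)"
        by (simp add: N_def mpoly_eval_add mpoly_eval_sum mpoly_eval_mult ev mpoly_eval_const \<sigma> matrix_matrix_mult_def)
      then show ?thesis by (simp add: D mat_def)
    qed
    then have "mpoly_eval \<sigma> (det N) = 1"
      by (subst det_hom[where h = "mpoly_eval \<sigma>"])
        (simp_all add: mpoly_eval_sum mpoly_eval_prod mpoly_eval_mult mpoly_eval_of_int)
    then have "det N \<noteq> 0" by auto
    then have "to_fract (det N) \<noteq> 0" by simp
    moreover have "to_fract (det N) = det (\<chi> i j. to_fract (N $ i $ j))"
      by (rule det_hom) (simp_all add: to_fract_sum to_fract_prod to_fract_of_int)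
    moreover have "(\<chi> i j. to_fract (N $ i $ j)) =
        (\<chi> i j. to_fract (Poly_Mapping.single 0 (D $ i $ j))) ** B_matrix E r symbolic_param +
        (\<chi> i j. if i = j \<and> j \<notin> B_cols r then 1 else 0)"
      by (simp add: vec_eq_iff N_def to_fract_sum matrix_matrix_mult_def sym)
    ultimately have "det ((\<chi> i j. to_fract (Poly_Mapping.single 0 (D $ i $ j))) ** B_matrix E r symbolic_param +
        (\<chi> i j. if i = j \<and> j \<notin> B_cols r then 1 else 0)) \<noteq> 0" by (simp only: not_False_eq_True)
    then show ?L by (rule trivial_kernel_on_if_det_nz)
  qed
qed

section \<open>Nondegenerate parameter points\<close>

text \<open>Full column rank of B(G) at the point \<open>A\<close>, phrased through commutators:
  \<open>X\<close> ranges over the off-diagonal matrices away from \<open>r\<close>, and only the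
  entries outside the zero pattern are compared.\<close>

definition nondegenerate :: "('n::finite \<times> 'n) set \<Rightarrow> 'n \<Rightarrow> real^'n^'n \<Rightarrow> bool"
  where "nondegenerate E r A \<longleftrightarrow>
    (\<forall>X. (\<forall>i j. (i, j) \<notin> B_cols r \<longrightarrow> X $ i $ j = 0) \<and>
      (\<forall>k l. (k, l) \<in> B_rows E \<longrightarrow> (X ** A) $ k $ l = (A ** X) $ k $ l) \<longrightarrow> X = 0)"

lemma B_matrix_mult_vector:
  fixes A :: "real^'n::finite^'n" and X :: "real^'n^'n"
  assumes A: "A \<in> param_space E" and X: "\<And>i j. (i, j) \<notin> B_cols r \<Longrightarrow> X $ i $ j = 0"
  shows "(B_matrix E r (\<lambda>i j. A $ i $ j) *v (\<chi> ij. X $ fst ij $ snd ij)) $ (k, l) =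
    (if (k, l) \<in> B_rows E then (A ** X) $ k $ l - (X ** A) $ k $ l else 0)"
proof (cases "(k, l) \<in> B_rows E")
  case True
  \<comment> \<open>The case distinction of \<open>B_entry\<close> collapses: entries of
    \<open>A\<close> at missing edges are 0, the diagonal of \<open>X\<close> is 0, and for
    \<open>i = k\<close>, \<open>j = l\<close> both terms together give the difference of diagonal
    entries.\<close>
  have entry: "B_matrix E r (\<lambda>i j. A $ i $ j) $ (k, l) $ (i, j) * X $ i $ j =
      (if j = l then A $ k $ i * X $ i $ j else 0) - (if i = k then X $ i $ j * A $ j $ l else 0)" for i j
    using A X[of i j] True unfolding B_matrix_def B_entry_def param_space_def
    by (auto simp: algebra_simps)
  have "(B_matrix E r (\<lambda>i j. A $ i $ j) *v (\<chi> ij. X $ fst ij $ snd ij)) $ (k, l) =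
      (\<Sum>(i, j)\<in>UNIV \<times> UNIV. B_matrix E r (\<lambda>i j. A $ i $ j) $ (k, l) $ (i, j) * X $ i $ j)"
    by (simp add: matrix_vector_mult_def case_prod_unfold)
  also have "\<dots> = (\<Sum>i\<in>UNIV. \<Sum>j\<in>UNIV. B_matrix E r (\<lambda>i j. A $ i $ j) $ (k, l) $ (i, j) * X $ i $ j)"
    by (rule sum.cartesian_product[symmetric])
  also have "\<dots> = (\<Sum>i\<in>UNIV. A $ k $ i * X $ i $ l) - (\<Sum>i\<in>UNIV. \<Sum>j\<in>UNIV. if i = k then X $ i $ j * A $ j $ l else 0)"
    unfolding entry by (simp add: sum_subtractf)
  also have "(\<Sum>i\<in>UNIV. \<Sum>j\<in>UNIV. if i = k then X $ i $ j * A $ j $ l else 0) = (\<Sum>j\<in>UNIV. X $ k $ j * A $ j $ l)"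
    by (subst sum.swap) simp
  finally show ?thesis using True by (simp add: matrix_matrix_mult_def)
next
  case False
  then show ?thesis by (simp add: matrix_vector_mult_def B_matrix_def)
qed

lemma nondegenerate_iff_trivial_kernel:
  fixes A :: "real^'n::finite^'n"
  assumes A: "A \<in> param_space E"
  shows "nondegenerate E r A \<longleftrightarrow> trivial_kernel_on (B_cols r) (B_matrix E r (\<lambda>i j. A $ i $ j))"
    (is "_ \<longleftrightarrow> trivial_kernel_on _ ?B")
proof
  assume nd: "nondegenerate E r A"
  show "trivial_kernel_on (B_cols r) ?B"
    unfolding trivial_kernel_on_def
  proof (intro allI impI)
    fix x :: "real^('n \<times> 'n)" assume x: "(\<forall>ij. ij \<notin> B_cols r \<longrightarrow> x $ ij = 0) \<and> ?B *v x = 0"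
    define X :: "real^'n^'n" where "X = (\<chi> i j. x $ (i, j))"
    have x_X: "x = (\<chi> ij. X $ fst ij $ snd ij)" by (simp add: X_def vec_eq_iff)
    have X: "X $ i $ j = 0" if "(i, j) \<notin> B_cols r" for i j
      using x that by (simp add: X_def)
    have "(X ** A) $ k $ l = (A ** X) $ k $ l" if "(k, l) \<in> B_rows E" for k l
    proof -
      have "(?B *v x) $ (k, l) = (A ** X) $ k $ l - (X ** A) $ k $ l"
        using that B_matrix_mult_vector[where A = A and X = X and r = r and E = E and k = k and l = l, OF A X] by (simp add: x_X[symmetric])
      then show ?thesis using x by simp
    qed
    then have "X = 0" using nd X unfolding nondegenerate_def by blast
    then show "x = 0" by (simp add: x_X vec_eq_iff)
  qed
next
  assume triv: "trivial_kernel_on (B_cols r) ?B"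
  show "nondegenerate E r A"
    unfolding nondegenerate_def
  proof (intro allI impI)
    fix X :: "real^'n^'n"
    assume X: "(\<forall>i j. (i, j) \<notin> B_cols r \<longrightarrow> X $ i $ j = 0) \<and>
      (\<forall>k l. (k, l) \<in> B_rows E \<longrightarrow> (X ** A) $ k $ l = (A ** X) $ k $ l)"
    then have "?B *v (\<chi> ij. X $ fst ij $ snd ij) = 0"
      using B_matrix_mult_vector[OF A, of r X] by (auto simp: vec_eq_iff)
    moreover have "\<forall>ij. ij \<notin> B_cols r \<longrightarrow> (\<chi> ij. X $ fst ij $ snd ij) $ ij = 0"
      using X by auto
    ultimately have "(\<chi> ij. X $ fst ij $ snd ij) = 0"
      using triv unfolding trivial_kernel_on_def by blast
    then show "X = 0" by (simp add: vec_eq_iff)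
  qed
qed

lemma B_full_column_rank_iff_nondegenerate:
  fixes E :: "('n::finite \<times> 'n) set"
  shows "B_full_column_rank E r \<longleftrightarrow> (\<exists>A\<in>param_space E. nondegenerate E r A)"
proof -
  \<comment> \<open>B(G) reads only diagonal and edge entries of \<open>a\<close>, so all others may
    be replaced by 0.\<close>
  have "\<exists>A\<in>param_space E. B_matrix E r a = B_matrix E r (\<lambda>i j. A $ i $ j)" for a :: "'n \<Rightarrow> 'n \<Rightarrow> real"
  proof
    let ?A = "\<chi> i j. if i = j \<or> (j, i) \<in> E then a i j else 0"
    show "?A \<in> param_space E" by (simp add: param_space_def)
    show "B_matrix E r a = B_matrix E r (\<lambda>i j. ?A $ i $ j)"
      by (auto simp: vec_eq_iff B_matrix_def B_entry_def)
  qed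
  then have "(\<exists>a :: 'n \<Rightarrow> 'n \<Rightarrow> real. trivial_kernel_on (B_cols r) (B_matrix E r a)) \<longleftrightarrow>
      (\<exists>A\<in>param_space E. nondegenerate E r A)"
    using nondegenerate_iff_trivial_kernel by metis
  then show ?thesis
    unfolding B_full_column_rank_def
    by (simp add: rank_eq_card_iff_trivial_kernel_on[OF B_matrix_zero_column] symbolic_trivial_kernel_iff)
qed

lemma real_polynomial_function_det:
  fixes M :: "'a::real_normed_vector \<Rightarrow> real^'n::finite^'n"
  assumes "\<And>i j. real_polynomial_function (\<lambda>x. M x $ i $ j)"
  shows "real_polynomial_function (\<lambda>x. det (M x))"
  unfolding det_def
  by (intro real_polynomial_function_sum real_polynomial_function.intros(2-4)
      real_polynomial_function_prod assms) auto

lemma real_polynomial_function_entry: "real_polynomial_function (\<lambda>A :: real^'n::finite^'m::finite. A $ i $ j)"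
  by (intro real_polynomial_function.intros(1) bounded_linear_compose[OF bounded_linear_vec_nth] bounded_linear_vec_nth)

lemma real_polynomial_function_if:
  "real_polynomial_function f \<Longrightarrow> real_polynomial_function g \<Longrightarrow>
    real_polynomial_function (\<lambda>x. if P then f x else g x)"
  by (cases P) simp_all

text \<open>Keep the left inverse \<open>D\<close> at \<open>A0\<close> fixed while \<open>A\<close>
  varies: the resulting determinant is polynomial in \<open>A\<close>, equals 1 at
  \<open>A0\<close>, and certifies nondegeneracy wherever it is nonzero.\<close>

lemma nondegenerate_polynomial:
  fixes A0 :: "real^'n::finite^'n"
  assumes A0: "A0 \<in> param_space E" "nondegenerate E r A0"
  obtains p where "real_polynomial_function p" "p A0 \<noteq> 0"
    "\<And>A. A \<in> param_space E \<Longrightarrow> p A \<noteq> 0 \<Longrightarrow> nondegenerate E r A"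
proof -
  let ?B = "\<lambda>A :: real^'n^'n. B_matrix E r (\<lambda>i j. A $ i $ j)"
  obtain D where D: "D ** ?B A0 = (\<chi> i j. if i = j \<and> j \<in> B_cols r then 1 else 0)"
    using trivial_kernel_on_left_inverse[OF nondegenerate_iff_trivial_kernel[OF A0(1), THEN iffD1, OF A0(2)]
        B_matrix_zero_column] by blast
  define p where "p A = det (D ** ?B A + (\<chi> i j. if i = j \<and> j \<notin> B_cols r then 1 else 0))" for A
  have "D ** ?B A0 + (\<chi> i j. if i = j \<and> j \<notin> B_cols r then 1 else 0) = mat 1"
    by (simp add: D vec_eq_iff mat_def)
  then have "p A0 \<noteq> 0" by (simp add: p_def)
  moreover have "nondegenerate E r A" if "A \<in> param_space E" "p A \<noteq> 0" for A
    using trivial_kernel_on_if_det_nz[OF that(2)[unfolded p_def]] nondegenerate_iff_trivial_kernel[OF that(1)]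
    by blast
  moreover have "real_polynomial_function p"
  proof -
    have "real_polynomial_function (\<lambda>A. ?B A $ kl $ ij)" for kl ij
      unfolding B_matrix_def B_entry_def
      by (cases kl; cases ij)
        (auto intro!: real_polynomial_function_entry real_polynomial_function_minus real_polynomial_function_diff
          real_polynomial_function.intros(2) real_polynomial_function_if)
    then show ?thesis
      unfolding p_def
      by (intro real_polynomial_function_det)
        (auto simp: matrix_matrix_mult_def intro!: real_polynomial_function_sum real_polynomial_function.intros(2-4))
  qed
  ultimately show thesis using that by blast
qed


subsection \<open>Spanning trees and generic controllability\<close>

text \<open>A spanning tree with edges directed away from \<open>r\<close>. The value
  \<open>par r\<close> is left open, and \<open>depth\<close> supports induction and products along
  the path to the root.\<close>

locale arborescence =
  fixes E :: "('n::finite \<times> 'n) set" and r :: 'n and par :: "'n \<Rightarrow> 'n" and depth :: "'n \<Rightarrow> nat"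
  assumes depth_root: "depth r = 0"
    and par_edge: "v \<noteq> r \<Longrightarrow> (par v, v) \<in> E"
    and depth_par: "v \<noteq> r \<Longrightarrow> depth v = Suc (depth (par v))"

text \<open>Breadth-first search: \<open>depth\<close> is the distance from \<open>r\<close>, and
  \<open>par\<close> picks a predecessor on a shortest path.\<close>

lemma strongly_connected_arborescence:
  assumes "strongly_connected E"
  obtains par depth where "arborescence E r par depth"
proof -
  define depth where "depth v = (LEAST k. (r, v) \<in> E ^^ k)" for v
  have ex: "\<exists>k. (r, v) \<in> E ^^ k" for v
    using assms by (simp add: strongly_connected_def rtrancl_is_UN_relpow)
  have path: "(r, v) \<in> E ^^ depth v" for v
    unfolding depth_def by (rule LeastI_ex[OF ex])
  have least: "depth v \<le> k" if "(r, v) \<in> E ^^ k" for v k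
    unfolding depth_def using that by (rule Least_le)
  have "\<exists>u. (u, v) \<in> E \<and> depth v = Suc (depth u)" if "v \<noteq> r" for v
  proof -
    have "depth v \<noteq> 0"
      using path[of v] that by (metis relpow_0_E)
    then obtain k where k: "depth v = Suc k"
      using not0_implies_Suc by blast
    then obtain u where u: "(r, u) \<in> E ^^ k" "(u, v) \<in> E"
      using path[of v] by auto
    have "depth v \<le> Suc (depth u)"
      using path[of u] u(2) by (intro least) auto
    with least[OF u(1)] k u(2) show ?thesis by auto
  qed
  then obtain par where "\<And>v. v \<noteq> r \<Longrightarrow> (par v, v) \<in> E \<and> depth v = Suc (depth (par v))"
    by metis
  moreover have "depth r = 0" using least[of r 0] by simp
  ultimately show thesis using that unfolding arborescence_def by metis
qed

context arborescence
begin

lemma depth_ancestor: "l \<le> depth i \<Longrightarrow> depth ((par ^^ l) i) = depth i - l"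
proof (induction l)
  case (Suc l)
  then have "(par ^^ l) i \<noteq> r" using depth_root by auto
  from depth_par[OF this] show ?case using Suc by simp
qed simp

lemma ancestor_neq: "0 < l \<Longrightarrow> l \<le> depth i \<Longrightarrow> (par ^^ l) i \<noteq> i"
  using depth_ancestor[of l i] by (metis diff_less order_less_le_trans order_less_irrefl)

lemma ancestor_neq_root: "l < depth i \<Longrightarrow> (par ^^ l) i \<noteq> r"
  using depth_ancestor[of l i] depth_root by auto

lemma ancestor_root: "(par ^^ depth i) i = r"
  using depth_ancestor[of "depth i" i] depth_par by fastforce

lemma par_induct [case_names root step]:
  assumes "P r" "\<And>v. v \<noteq> r \<Longrightarrow> P (par v) \<Longrightarrow> P v"
  shows "P v"
proof (induction "depth v" arbitrary: v)
  case 0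
  then have "v = r" using depth_par[of v] by (cases "v = r") auto
  with assms(1) show ?case by simp
next
  case (Suc k)
  then have "v \<noteq> r" using depth_root by auto
  moreover from this Suc(2) have "k = depth (par v)" using depth_par by simp
  ultimately show ?case using Suc(1) assms(2) by blast
qed

text \<open>The factor forced by requiring every tree entry to become 1, as a product over the path
  from \<open>v\<close> to the root. As the inverse of 0 is 0, a vanishing entry on the path makes
  it 0 and excludes the matrix from the domain.\<close>

definition tree_scale :: "'n \<Rightarrow> real^'n^'n \<Rightarrow> real"
  where "tree_scale v A = (\<Prod>k<depth v. inverse (A $ (par ^^ k) v $ (par ^^ Suc k) v))"

lemma tree_scale_root [simp]: "tree_scale r A = 1"
  by (simp add: tree_scale_def depth_root)

lemma tree_scale_step:
  assumes "v \<noteq> r" shows "tree_scale v A = inverse (A $ v $ par v) * tree_scale (par v) A"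
  unfolding tree_scale_def depth_par[OF assms] prod.lessThan_Suc_shift
  by (simp add: funpow_swap1)

lemma tree_scale_nonzero_iff:
  "(\<forall>v. tree_scale v A \<noteq> 0) \<longleftrightarrow> (\<forall>v. v \<noteq> r \<longrightarrow> A $ v $ par v \<noteq> 0)"
proof
  assume "\<forall>v. tree_scale v A \<noteq> 0"
  then show "\<forall>v. v \<noteq> r \<longrightarrow> A $ v $ par v \<noteq> 0"
    by (metis inverse_zero mult_zero_left tree_scale_step)
next
  assume nz: "\<forall>v. v \<noteq> r \<longrightarrow> A $ v $ par v \<noteq> 0"
  have "tree_scale v A \<noteq> 0" for v
    by (induction v rule: par_induct) (use nz in \<open>auto simp: tree_scale_step\<close>)
  then show "\<forall>v. tree_scale v A \<noteq> 0" by blast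
qed

lemma continuous_on_tree_scale:
  assumes "\<And>A v. A \<in> S \<Longrightarrow> v \<noteq> r \<Longrightarrow> A $ v $ par v \<noteq> 0"
  shows "continuous_on S (tree_scale v)"
proof (induction v rule: par_induct)
  case root
  show ?case by simp
next
  case (step v)
  have "continuous_on S (\<lambda>A. inverse (A $ v $ par v) * tree_scale (par v) A)"
    using assms step by (intro continuous_intros) auto
  then show ?case using step by (simp add: tree_scale_step cong: continuous_on_cong)
qed

text \<open>
  With distinct diagonal entries, the matrix of the tree is diagonalizable, and each of its left
  eigenvectors is supported on the path from \<open>r\<close> to some vertex, without vanishing at \<open>r\<close>.
\<close>

lemma controllable_exists:
  "\<exists>A\<in>param_space E. det (krylov_matrix r A) \<noteq> 0"
proof
  define \<delta> :: "'n \<Rightarrow> real" where "\<delta> v = real (vertex_index v)" for v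
  have inj\<delta>: "\<delta> u = \<delta> v \<longleftrightarrow> u = v" for u v
    using bij_betw_vertex_index[where 'n = 'n] by (auto simp: \<delta>_def bij_betw_def inj_def)
  define A :: "real^'n^'n"
    where "A = (\<chi> v u. if u = v then \<delta> v else if v \<noteq> r \<and> u = par v then 1 else 0)"
  show "A \<in> param_space E"
    using par_edge by (auto simp: param_space_def A_def)
  have par_neq: "par v \<noteq> v" if "v \<noteq> r" for v
    using depth_par[OF that] by auto
  have A_axis: "transpose A *v axis v 1 = \<delta> v *\<^sub>R axis v 1 + (if v = r then 0 else axis (par v) 1)" for v
  proof -
    have "(transpose A *v axis v 1) $ i = A $ v $ i" for i
      by (simp add: matrix_vector_mult_basis column_def transpose_def)
    then show ?thesis
      using par_neq[of v] by (cases "v = r") (auto simp: vec_eq_iff A_def axis_def)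
  qed
  have eigen: "\<exists>w. transpose A *v w = \<delta> i *\<^sub>R w \<and> w $ r \<noteq> 0" for i
  proof -
    define a where "a l = (par ^^ l) i" for l
    \<comment> \<open>The coefficients of the eigenvector along the path to the root; comparing
      coefficients at \<open>a (Suc l)\<close> gives the recursion \<open>c_Suc\<close>.\<close>
    define c where "c l = (\<Prod>k<l. inverse (\<delta> i - \<delta> (a (Suc k))))" for l
    define n where "n = depth i"
    have c_Suc: "c (Suc l) * (\<delta> i - \<delta> (a (Suc l))) = c l" if "l < n" for l
      using ancestor_neq[of "Suc l" i] that by (simp add: c_def inj\<delta> a_def n_def)
    define w :: "real^'n" where "w = (\<Sum>l\<le>n. c l *\<^sub>R axis (a l) 1)"
    have "transpose A *v w = (\<Sum>l\<le>n. c l *\<^sub>R (transpose A *v axis (a l) 1))"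
      by (simp add: w_def linear_sum[OF matrix_vector_mul_linear] linear_cmul[OF matrix_vector_mul_linear])
    also have "\<dots> = (\<Sum>l\<le>n. (c l * \<delta> (a l)) *\<^sub>R axis (a l) 1) +
        (\<Sum>l\<le>n. c l *\<^sub>R (if a l = r then 0 else axis (par (a l)) 1))"
      unfolding A_axis by (simp add: scaleR_right_distrib sum.distrib)
    also have "(\<Sum>l\<le>n. c l *\<^sub>R (if a l = r then 0 else axis (par (a l)) 1)) = (\<Sum>l<n. c l *\<^sub>R axis (a (Suc l)) (1::real))"
    proof -
      have "(\<Sum>l\<le>n. c l *\<^sub>R (if a l = r then 0 else axis (par (a l)) (1::real))) =
          (\<Sum>l<n. c l *\<^sub>R (if a l = r then 0 else axis (par (a l)) 1))"
        using ancestor_root[of i] by (simp add: lessThan_Suc_atMost[symmetric] a_def n_def)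
      also have "\<dots> = (\<Sum>l<n. c l *\<^sub>R axis (a (Suc l)) 1)"
        using ancestor_neq_root[of _ i] by (intro sum.cong) (auto simp: a_def n_def)
      finally show ?thesis .
    qed
    also have "\<dots> = (\<Sum>l<n. (c (Suc l) * (\<delta> i - \<delta> (a (Suc l)))) *\<^sub>R axis (a (Suc l)) (1::real))"
      by (intro sum.cong) (auto simp: c_Suc)
    also have "\<dots> = (\<Sum>l\<le>n. (c l * (\<delta> i - \<delta> (a l))) *\<^sub>R axis (a l) 1)"
      unfolding lessThan_Suc_atMost[symmetric] sum.lessThan_Suc_shift by (simp add: a_def)
    also have "(\<Sum>l\<le>n. (c l * \<delta> (a l)) *\<^sub>R axis (a l) 1) + \<dots> = \<delta> i *\<^sub>R w"
      unfolding w_def scaleR_sum_right sum.distrib[symmetric]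
      by (intro sum.cong) (simp_all add: right_diff_distrib scaleR_left_diff_distrib mult.commute)
    finally have "transpose A *v w = \<delta> i *\<^sub>R w" .
    moreover have "w $ r = (\<Sum>l\<le>n. if l = n then c l else 0)"
      unfolding w_def sum_component
    proof (intro sum.cong refl)
      fix l assume "l \<in> {..n}"
      then show "(c l *\<^sub>R axis (a l) 1 :: real^'n) $ r = (if l = n then c l else 0)"
        using ancestor_neq_root[of l i] ancestor_root[of i] by (auto simp: axis_def a_def n_def)
    qed
    moreover have "c n \<noteq> 0"
    proof -
      have "a (Suc k) \<noteq> i" if "k < n" for k
        using ancestor_neq[of "Suc k" i] that unfolding a_def n_def by simp
      then show ?thesis unfolding c_def by (auto simp: inj\<delta>)
    qed
    ultimately show ?thesis by auto
  qed
  have "y = 0" if y: "krylov_matrix r A *v y = 0" for y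
  proof -
    \<comment> \<open>A relation \<open>y\<close> between the Krylov columns is a polynomial of
      degree below n. Pairing with the eigenvectors makes all n distinct eigenvalues its
      roots.\<close>
    define p where "p = (\<Sum>j\<in>UNIV. monom (y $ j) (vertex_index j))"
    have root: "poly p (\<delta> i) = 0" for i
    proof -
      obtain w where w: "transpose A *v w = \<delta> i *\<^sub>R w" "w $ r \<noteq> 0" using eigen by blast
      have "w \<bullet> krylov r A k = \<delta> i ^ k * w $ r" for k
      proof (induction k)
        case (Suc k)
        have "w \<bullet> krylov r A (Suc k) = (transpose A *v w) \<bullet> krylov r A k"
          by (simp add: krylov_Suc dot_lmul_matrix)
        then show ?case using Suc w by simp
      qed (simp add: inner_axis)
      moreover have "w \<bullet> (krylov_matrix r A *v y) = (\<Sum>j\<in>UNIV. y $ j * (w \<bullet> krylov r A (vertex_index j)))"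
        unfolding inner_vec_def matrix_vector_mult_def krylov_matrix_def
        by (simp add: sum_distrib_left mult_ac) (rule sum.swap)
      ultimately have "poly p (\<delta> i) * w $ r = 0"
        using y by (simp add: p_def poly_sum poly_monom sum_distrib_right mult.assoc)
      with w(2) show ?thesis by simp
    qed
    have "p = 0"
    proof (rule ccontr)
      assume p: "p \<noteq> 0"
      have "degree p < CARD('n)"
      proof -
        have "degree p \<le> CARD('n) - 1"
          unfolding p_def
        proof (intro degree_sum_le)
          fix j :: 'n
          have "vertex_index j < CARD('n)"
            using bij_betw_vertex_index[where 'n = 'n] by (auto simp: bij_betw_def)
          then show "degree (monom (y $ j) (vertex_index j)) \<le> CARD('n) - 1"
            using degree_monom_le[of "y $ j" "vertex_index j"] by linarith
        qed auto
        then show ?thesis using zero_less_card_finite[where 'a = 'n] by linarith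
      qed
      moreover have "CARD('n) = card (range \<delta>)"
        using inj\<delta> by (simp add: card_image inj_def)
      moreover have "card (range \<delta>) \<le> card {x. poly p x = 0}"
        using root by (intro card_mono poly_roots_finite p) auto
      ultimately show False using card_poly_roots_bound[OF p] by linarith
    qed
    moreover have "coeff p (vertex_index i) = (\<Sum>j\<in>UNIV. if j = i then y $ j else 0)" for i
      unfolding p_def coeff_sum
      using inj\<delta> by (intro sum.cong) (auto simp: \<delta>_def)
    ultimately show "y = 0" by (simp add: vec_eq_iff)
  qed
  then show "det (krylov_matrix r A) \<noteq> 0"
    by (metis invertible_det_nz invertible_left_inverse matrix_left_invertible_ker)
qed

end

section \<open>Generic controllability and observability\<close>

lemma subspace_param_space: "subspace (param_space E)"
  by (simp add: subspace_def param_space_def)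

lemma transpose_param_space: "transpose A \<in> param_space E \<longleftrightarrow> A \<in> param_space (E\<inverse>)"
  by (auto simp: param_space_def transpose_def)

lemma strongly_connected_controllable:
  assumes "strongly_connected E"
  shows "\<exists>A\<in>param_space E. det (krylov_matrix r A) \<noteq> 0"
  using strongly_connected_arborescence[OF assms] arborescence.controllable_exists by metis

text \<open>Reversing all edges transposes the parameter space and keeps strong connectivity, so
  this is controllability of the reversed graph.\<close>

lemma strongly_connected_observable:
  assumes "strongly_connected E"
  shows "\<exists>A\<in>param_space E. det (krylov_matrix r (transpose A)) \<noteq> 0"
proof -
  have "strongly_connected (E\<inverse>)"
    using assms by (simp add: strongly_connected_def rtrancl_converse)
  then obtain A where "A \<in> param_space (E\<inverse>)" "det (krylov_matrix r A) \<noteq> 0"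
    using strongly_connected_controllable by blast
  then show ?thesis by (intro bexI[of _ "transpose A"]) (auto simp: transpose_param_space)
qed

lemma real_polynomial_function_krylov: "real_polynomial_function (\<lambda>A. krylov r A k $ i)"
proof (induction k arbitrary: i)
  case 0
  show ?case by (auto intro: real_polynomial_function.intros)
next
  case (Suc k)
  have "real_polynomial_function (\<lambda>A. \<Sum>j\<in>UNIV. A $ i $ j * krylov r A k $ j)"
    by (intro real_polynomial_function_sum real_polynomial_function.intros(4)
        real_polynomial_function_entry Suc) auto
  then show ?case by (simp add: krylov_Suc matrix_vector_mult_def)
qed

lemma real_polynomial_function_det_krylov: "real_polynomial_function (\<lambda>A. det (krylov_matrix r A))"
  by (intro real_polynomial_function_det) (simp add: krylov_matrix_def real_polynomial_function_krylov)

lemma polynomial_function_transpose: "polynomial_function (transpose :: real^'n::finite^'m::finite \<Rightarrow> _)"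
  by (intro polynomial_function_bounded_linear linear_conv_bounded_linear[THEN iffD1] linearI)
    (auto simp: transpose_def vec_eq_iff)

lemma real_polynomial_function_det_krylov_transpose:
  "real_polynomial_function (\<lambda>A. det (krylov_matrix r (transpose A)))"
  using real_polynomial_function_compose[OF polynomial_function_transpose real_polynomial_function_det_krylov]
  by (simp add: o_def)

section \<open>Invariance of the generic conditions under diagonal scaling\<close>

text \<open>Scaling with constant factors; \<open>rescale\<close> is the same with factors that
  depend on the matrix.\<close>

definition scale_by :: "('n \<Rightarrow> real) \<Rightarrow> real^'n::finite^'n \<Rightarrow> real^'n^'n"
  where "scale_by g A = (\<chi> i j. A $ i $ j * g i / g j)"

lemma rescale_eq_scale_by: "rescale f A = scale_by (\<lambda>i. f i A) A"
  by (simp add: rescale_def scale_by_def)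

lemma scale_by_nth: "scale_by g A $ i $ j = A $ i $ j * g i / g j"
  by (simp add: scale_by_def)

lemma scale_by_param_space: "A \<in> param_space E \<Longrightarrow> scale_by g A \<in> param_space E"
  by (simp add: param_space_def scale_by_def)

lemma krylov_scale_by:
  assumes "\<And>i. g i \<noteq> 0" "g r = 1"
  shows "krylov r (scale_by g A) k $ i = g i * krylov r A k $ i"
proof (induction k arbitrary: i)
  case 0
  show ?case using assms by (simp add: axis_def)
next
  case (Suc k)
  have "krylov r (scale_by g A) (Suc k) $ i = (\<Sum>j\<in>UNIV. A $ i $ j * g i / g j * (g j * krylov r A k $ j))"
    by (simp add: krylov_Suc matrix_vector_mult_def Suc scale_by_nth)
  also have "\<dots> = (\<Sum>j\<in>UNIV. g i * (A $ i $ j * krylov r A k $ j))"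
    using assms(1) by (intro sum.cong) auto
  finally show ?case by (simp add: krylov_Suc matrix_vector_mult_def sum_distrib_left)
qed

lemma det_krylov_scale_by:
  assumes "\<And>i. g i \<noteq> 0" "g r = 1"
  shows "det (krylov_matrix r (scale_by g A)) \<noteq> 0 \<longleftrightarrow> det (krylov_matrix r A) \<noteq> 0"
proof -
  have "krylov_matrix r (scale_by g A) = (\<chi> i. g i *s krylov_matrix r A $ i)"
    by (simp add: krylov_matrix_def krylov_scale_by[where g = g and r = r, OF assms] vec_eq_iff)
  then show ?thesis
    using assms by (simp add: det_rows_mul)
qed

lemma transpose_scale_by: "transpose (scale_by g A) = scale_by (\<lambda>i. inverse (g i)) (transpose A)"
  by (simp add: scale_by_def transpose_def vec_eq_iff field_simps)

lemma det_krylov_transpose_scale_by: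
  assumes "\<And>i. g i \<noteq> 0" "g r = 1"
  shows "det (krylov_matrix r (transpose (scale_by g A))) \<noteq> 0 \<longleftrightarrow> det (krylov_matrix r (transpose A)) \<noteq> 0"
  unfolding transpose_scale_by using assms by (intro det_krylov_scale_by) auto

text \<open>Conjugating \<open>X\<close> back by the diagonal matrix multiplies each commutator
  entry by a nonzero factor and preserves the supports involved.\<close>

lemma nondegenerate_scale_by:
  fixes A :: "real^'n::finite^'n"
  assumes g: "\<And>i. g i \<noteq> 0" and nd: "nondegenerate E r A"
  shows "nondegenerate E r (scale_by g A)"
  unfolding nondegenerate_def
proof (intro allI impI)
  fix X :: "real^'n^'n"
  assume X: "(\<forall>i j. (i, j) \<notin> B_cols r \<longrightarrow> X $ i $ j = 0) \<and>
    (\<forall>k l. (k, l) \<in> B_rows E \<longrightarrow> (X ** scale_by g A) $ k $ l = (scale_by g A ** X) $ k $ l)"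
  define Y where "Y = scale_by (\<lambda>i. inverse (g i)) X"
  have "(Y ** A) $ k $ l = (X ** scale_by g A) $ k $ l * (g l / g k)" for k l
    unfolding matrix_matrix_mult_def Y_def scale_by_def vec_lambda_beta sum_distrib_right using g
    by (intro sum.cong) (auto simp: field_simps)
  moreover have "(A ** Y) $ k $ l = (scale_by g A ** X) $ k $ l * (g l / g k)" for k l
    unfolding matrix_matrix_mult_def Y_def scale_by_def vec_lambda_beta sum_distrib_right using g
    by (intro sum.cong) (auto simp: field_simps)
  ultimately have "\<forall>k l. (k, l) \<in> B_rows E \<longrightarrow> (Y ** A) $ k $ l = (A ** Y) $ k $ l"
    using X by simp
  moreover have "\<forall>i j. (i, j) \<notin> B_cols r \<longrightarrow> Y $ i $ j = 0"
    using X by (simp add: Y_def scale_by_def)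
  ultimately have "Y = 0" using nd unfolding nondegenerate_def by blast
  then show "X = 0" using g by (simp add: Y_def scale_by_def vec_eq_iff)
qed


subsection \<open>Full rank implies identifiability\<close>

lemma bounded_bilinear_matrix_mult: "bounded_bilinear ((**) :: real^'n::finite^'n \<Rightarrow> real^'n^'n \<Rightarrow> real^'n^'n)"
  unfolding bilinear_conv_bounded_bilinear[symmetric] bilinear_def
  by (intro conjI allI linearI)
    (simp_all add: matrix_add_ldistrib matrix_matrix_mult_def vec_eq_iff distrib_left distrib_right sum.distrib
      sum_distrib_left mult_ac)

text \<open>The differences \<open>T - mat 1\<close> for matrices \<open>T\<close> that fix the unit
  vector of \<open>r\<close> from both sides, and also the tangent space of the group formed by the
  invertible ones.\<close>

definition corner_free :: "'n::finite \<Rightarrow> (real^'n^'n) set"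
  where "corner_free r = {X. \<forall>i. X $ i $ r = 0 \<and> X $ r $ i = 0}"

lemma subspace_corner_free: "subspace (corner_free r)"
  by (simp add: subspace_def corner_free_def)

text \<open>Removing the diagonal of \<open>X\<close> changes the commutator at (k, l) by a multiple
  of the entry of \<open>A\<close> there, which is 0 on \<open>B_rows E\<close>.\<close>

lemma nondegenerate_imp_diagonal:
  fixes A :: "real^'n::finite^'n"
  assumes A: "A \<in> param_space E" and nd: "nondegenerate E r A" and X: "X \<in> corner_free r"
    and comm: "\<And>k l. (k, l) \<in> B_rows E \<Longrightarrow> (X ** A) $ k $ l = (A ** X) $ k $ l" and "i \<noteq> j"
  shows "X $ i $ j = 0"
proof -
  define Y where "Y = (\<chi> i j. if i = j then 0 else X $ i $ j)"
  have "(Y ** A) $ k $ l = (A ** Y) $ k $ l" if kl: "(k, l) \<in> B_rows E" for k l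
  proof -
    have "A $ k $ l = 0" using A kl by (auto simp: param_space_def B_rows_def)
    have "(Y ** A) $ k $ l = (X ** A) $ k $ l"
      unfolding matrix_matrix_mult_def Y_def using \<open>A $ k $ l = 0\<close> by (auto intro!: sum.cong)
    moreover have "(A ** Y) $ k $ l = (A ** X) $ k $ l"
      unfolding matrix_matrix_mult_def Y_def using \<open>A $ k $ l = 0\<close> by (auto intro!: sum.cong)
    ultimately show ?thesis using comm[OF kl] by simp
  qed
  moreover have "Y $ i $ j = 0" if "(i, j) \<notin> B_cols r" for i j
    using that X by (auto simp: Y_def B_cols_def corner_free_def)
  ultimately have "Y = 0" using nd unfolding nondegenerate_def by blast
  then have "Y $ i $ j = 0" by simp
  then show ?thesis
    using \<open>i \<noteq> j\<close> by (simp add: Y_def)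
qed

context arborescence
begin

section \<open>The slice of tree-normalized parameters\<close>

definition slice_directions :: "(real^'n^'n) set"
  where "slice_directions = {C \<in> param_space E. \<forall>v. v \<noteq> r \<longrightarrow> C $ v $ par v = 0}"

definition slice :: "(real^'n^'n) set"
  where "slice = {A \<in> param_space E. \<forall>v. v \<noteq> r \<longrightarrow> A $ v $ par v = 1}"

text \<open>The coordinate projection onto \<open>slice_directions\<close>: it keeps the diagonal
  and the edges outside the tree.\<close>

definition slice_projection :: "real^'n^'n \<Rightarrow> real^'n^'n"
  where "slice_projection M =
    (\<chi> i j. if i = j \<or> (j, i) \<in> E \<and> \<not> (i \<noteq> r \<and> j = par i) then M $ i $ j else 0)"

lemma par_neq: "v \<noteq> r \<Longrightarrow> par v \<noteq> v"
  using depth_par[of v] by auto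

lemma slice_projection_id: "C \<in> slice_directions \<Longrightarrow> slice_projection C = C"
  by (auto simp: slice_projection_def slice_directions_def param_space_def vec_eq_iff)

lemma bounded_linear_slice_projection: "bounded_linear slice_projection"
  unfolding linear_conv_bounded_linear[symmetric]
  by (intro linearI) (auto simp: slice_projection_def vec_eq_iff)

text \<open>Commutation at a tree edge equates the diagonal entries of its two ends, so the zero at
  the root spreads over the tree.\<close>

lemma diagonal_commuting_on_tree:
  assumes diag: "\<And>i j. i \<noteq> j \<Longrightarrow> X $ i $ j = 0" and X: "X \<in> corner_free r"
    and tree: "\<And>v. v \<noteq> r \<Longrightarrow> A $ v $ par v \<noteq> 0"
    and comm: "\<And>v. v \<noteq> r \<Longrightarrow> (X ** A) $ v $ par v = (A ** X) $ v $ par v"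
  shows "X = 0"
proof -
  have XA: "(X ** A) $ k $ l = X $ k $ k * A $ k $ l" for k l
  proof -
    have "(X ** A) $ k $ l = (\<Sum>j\<in>UNIV. if j = k then X $ k $ k * A $ k $ l else 0)"
      unfolding matrix_matrix_mult_def vec_lambda_beta using diag by (intro sum.cong) auto
    then show ?thesis by simp
  qed
  have AX: "(A ** X) $ k $ l = A $ k $ l * X $ l $ l" for k l
  proof -
    have "(A ** X) $ k $ l = (\<Sum>j\<in>UNIV. if j = l then A $ k $ l * X $ l $ l else 0)"
      unfolding matrix_matrix_mult_def vec_lambda_beta using diag by (intro sum.cong) auto
    then show ?thesis by simp
  qed
  have "X $ v $ v = 0" for v
  proof (induction v rule: par_induct)
    case root
    show ?case using X by (simp add: corner_free_def)
  next
    case (step v)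
    then show ?case using comm[of v] tree[of v] by (simp add: XA AX)
  qed
  then show ?thesis using diag by (metis vec_eq_iff zero_index)
qed

text \<open>A linear map that is injective on \<open>corner_free r\<close> is bounded below there.
  For two points near \<open>B\<close> with equal values, the matrix \<open>X = T - mat 1\<close>
  has an image under it that is too small relative to \<open>X\<close>, so
  \<open>X = 0\<close>.\<close>

lemma double_charpoly_locally_injective:
  assumes B: "B \<in> slice" "nondegenerate E r B"
    "det (krylov_matrix r B) \<noteq> 0" "det (krylov_matrix r (transpose B)) \<noteq> 0"
  obtains N where "openin (top_of_set slice) N" "B \<in> N" "inj_on (double_charpoly r) N"
proof -
  let ?\<pi> = "\<lambda>M. M - slice_projection M"
  have bl\<pi>: "bounded_linear ?\<pi>"
    by (intro bounded_linear_sub bounded_linear_ident bounded_linear_slice_projection)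
  have B_param: "B \<in> param_space E" and B_tree: "\<And>v. v \<noteq> r \<Longrightarrow> B $ v $ par v = 1"
    using B(1) by (auto simp: slice_def)
  \<comment> \<open>The part of the commutator with \<open>B\<close> that leaves the slice: the
    entries at missing edges and at tree edges.\<close>
  define \<Phi> where "\<Phi> X = ?\<pi> (X ** B - B ** X)" for X
  have bl\<Phi>: "bounded_linear \<Phi>"
    unfolding \<Phi>_def
    by (rule bounded_linear_compose[OF bl\<pi>])
      (intro bounded_linear_sub bounded_bilinear.bounded_linear_left[OF bounded_bilinear_matrix_mult]
        bounded_bilinear.bounded_linear_right[OF bounded_bilinear_matrix_mult])
  have "X = 0" if X: "X \<in> corner_free r" "\<Phi> X = 0" for X
  proof -
    have eq: "(X ** B) $ k $ l = (B ** X) $ k $ l"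
      if "k \<noteq> l" "(l, k) \<notin> E \<or> k \<noteq> r \<and> l = par k" for k l
    proof -
      have "\<Phi> X $ k $ l = 0" using X by simp
      then show ?thesis using that by (auto simp: \<Phi>_def slice_projection_def)
    qed
    have "X $ i $ j = 0" if "i \<noteq> j" for i j
      by (rule nondegenerate_imp_diagonal[OF B_param B(2) X(1) _ that])
        (auto simp: B_rows_def intro: eq)
    moreover have "(X ** B) $ v $ par v = (B ** X) $ v $ par v" if "v \<noteq> r" for v
      using eq[of v "par v"] that par_neq[OF that] by simp
    ultimately show "X = 0"
      using diagonal_commuting_on_tree[of X B] X(1) B_tree by simp
  qed
  then have "\<exists>e>0. \<forall>X\<in>corner_free r. e * norm X \<le> norm (\<Phi> X)"
    using injective_imp_isometric[OF closed_subspace[OF subspace_corner_free] subspace_corner_free bl\<Phi>] by simp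
  then obtain e where e: "e > 0" "\<And>X. X \<in> corner_free r \<Longrightarrow> e * norm X \<le> norm (\<Phi> X)"
    by blast
  obtain K where K: "K > 0" "\<And>(M :: real^'n^'n) (N :: real^'n^'n). norm (M ** N) \<le> norm M * norm N * K"
    using bounded_bilinear.pos_bounded[OF bounded_bilinear_matrix_mult[where 'n = 'n]] by blast
  obtain P where P: "P > 0" "\<And>M. norm (?\<pi> M) \<le> norm M * P"
    using bounded_linear.pos_bounded[OF bl\<pi>] by metis
  \<comment> \<open>Chosen so that \<open>2 * \<epsilon> * K * P = e\<close>, which balances the
    perturbation estimate against the lower bound for \<open>\<Phi>\<close>.\<close>
  define \<epsilon> where "\<epsilon> = e / (2 * K * P)"
  have \<epsilon>: "\<epsilon> > 0" using e K P by (simp add: \<epsilon>_def)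
  define W where "W = {A. det (krylov_matrix r A) \<noteq> 0} \<inter> {A. det (krylov_matrix r (transpose A)) \<noteq> 0}"
  have cont: "continuous_on UNIV p" if "real_polynomial_function p" for p :: "real^'n^'n \<Rightarrow> real"
    using that by (simp add: continuous_on_polymonial_function real_polynomial_function_eq)
  have "open W"
    unfolding W_def
    by (intro open_Int open_Collect_neq cont real_polynomial_function_det_krylov
        real_polynomial_function_det_krylov_transpose continuous_on_const)
  define N where "N = slice \<inter> (ball B \<epsilon> \<inter> W)"
  have "openin (top_of_set slice) N"
    unfolding N_def using \<open>open W\<close> by (intro openin_open_Int open_Int) auto
  moreover have "B \<in> N" using B \<epsilon> by (simp add: N_def W_def)
  moreover have "inj_on (double_charpoly r) N"
  proof (rule inj_onI)
    fix A A' assume AN: "A \<in> N" "A' \<in> N" and c: "double_charpoly r A = double_charpoly r A'"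
    have h: "krylov r A k $ r = krylov r A' k $ r" for k
      using c charpolys_eq_imp_krylov_eq unfolding double_charpoly_eq_iff by blast
    obtain T where T: "T ** A = A' ** T" "T *v axis r 1 = axis r 1" "axis r 1 v* T = axis r 1"
      using realization_unique[of r A A'] h AN unfolding N_def W_def by blast
    define X where "X = T - mat 1"
    have "X \<in> corner_free r"
    proof -
      have "X *v axis r 1 = 0" by (simp add: X_def matrix_vector_mult_diff_rdistrib T)
      moreover have "axis r 1 v* X = 0" by (simp add: X_def vector_matrix_mult_diff_rdistrib T)
      moreover have "(axis r 1 v* X) $ i = X $ r $ i" for i
      proof -
        have "(axis r 1 v* X) $ i = (transpose X *v axis r 1) $ i" by simp
        also have "\<dots> = X $ r $ i" unfolding matrix_vector_mult_basis column_def transpose_def by simp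
        finally show ?thesis .
      qed
      moreover have "(X *v axis r 1) $ i = X $ i $ r" for i
        by (simp add: matrix_vector_mult_basis column_def)
      ultimately show ?thesis by (simp add: corner_free_def)
    qed
    have "A' - A = X ** A - A' ** X"
      using T(1) by (simp add: X_def matrix_diff_ldistrib matrix_diff_rdistrib)
    moreover have "A' - A \<in> slice_directions"
      using AN by (auto simp: N_def slice_def slice_directions_def param_space_def)
    ultimately have "?\<pi> (X ** A - A' ** X) = 0"
      using slice_projection_id by simp
    \<comment> \<open>The first summand is \<open>A' - A\<close> and lies in the slice directions;
      the second is small compared with \<open>X\<close>.\<close>
    moreover have "X ** B - B ** X = (X ** A - A' ** X) + (X ** (B - A) - (B - A') ** X)"
      by (simp add: matrix_diff_ldistrib matrix_diff_rdistrib)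
    ultimately have "\<Phi> X = ?\<pi> (X ** (B - A) - (B - A') ** X)"
      unfolding \<Phi>_def using bounded_linear.linear[OF bl\<pi>] by (simp add: linear_add[of ?\<pi>])
    then have "norm (\<Phi> X) \<le> norm (X ** (B - A) - (B - A') ** X) * P"
      using P(2) by simp
    also have "\<dots> \<le> (norm X * norm (B - A) * K + norm (B - A') * norm X * K) * P"
      using P(1) K(2)[of X "B - A"] K(2)[of "B - A'" X]
      by (intro mult_right_mono order_trans[OF norm_triangle_ineq4] add_mono) auto
    also have "\<dots> = (norm (B - A) + norm (B - A')) * (norm X * K * P)"
      by (simp add: algebra_simps)
    finally have le: "e * norm X \<le> (norm (B - A) + norm (B - A')) * (norm X * K * P)"
      using e(2)[OF \<open>X \<in> corner_free r\<close>] by linarith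
    have "X = 0"
    proof (rule ccontr)
      assume "X \<noteq> 0"
      have "norm (B - A) + norm (B - A') < 2 * \<epsilon>"
        using AN by (simp add: N_def dist_norm)
      then have "(norm (B - A) + norm (B - A')) * (norm X * K * P) < 2 * \<epsilon> * (norm X * K * P)"
        using \<open>X \<noteq> 0\<close> K(1) P(1) by (intro mult_strict_right_mono) auto
      also have "\<dots> = e * norm X" using K(1) P(1) by (simp add: \<epsilon>_def field_simps)
      finally show False using le by linarith
    qed
    then show "A = A'" using \<open>A' - A = X ** A - A' ** X\<close> by simp
  qed
  ultimately show thesis using that by blast
qed

section \<open>Tree normalization as a scaling reparametrization\<close>

definition tree_prod :: "real^'n^'n \<Rightarrow> real"
  where "tree_prod A = (\<Prod>v\<in>UNIV - {r}. A $ v $ par v)"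

lemma tree_prod_nonzero_iff: "tree_prod A \<noteq> 0 \<longleftrightarrow> (\<forall>v. v \<noteq> r \<longrightarrow> A $ v $ par v \<noteq> 0)"
  by (auto simp: tree_prod_def)

lemma real_polynomial_function_tree_prod: "real_polynomial_function tree_prod"
  unfolding tree_prod_def by (intro real_polynomial_function_prod real_polynomial_function_entry) auto

lemma tree_prod_nonzero_exists: "\<exists>A\<in>param_space E. tree_prod A \<noteq> 0"
proof
  let ?A = "(\<chi> i j. if (j, i) \<in> E then 1 else 0) :: real^'n^'n"
  show "?A \<in> param_space E" by (simp add: param_space_def)
  show "tree_prod ?A \<noteq> 0" using par_edge by (simp add: tree_prod_nonzero_iff)
qed

lemma scaling_domain_tree_scale: "scaling_domain E tree_scale = {A \<in> param_space E. tree_prod A \<noteq> 0}"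
  by (simp add: scaling_domain_def tree_scale_nonzero_iff tree_prod_nonzero_iff)

lemma scaling_reparametrization_tree_scale: "scaling_reparametrization E r tree_scale"
  unfolding scaling_reparametrization_def
proof (intro conjI ballI allI)
  have "continuous_on UNIV tree_prod"
    using real_polynomial_function_tree_prod
    by (simp add: continuous_on_polymonial_function real_polynomial_function_eq)
  then have "open {A. tree_prod A \<noteq> 0}"
    by (intro open_Collect_neq) auto
  moreover have "scaling_domain E tree_scale = param_space E \<inter> {A. tree_prod A \<noteq> 0}"
    by (auto simp: scaling_domain_tree_scale)
  ultimately show "openin (top_of_set (param_space E)) (scaling_domain E tree_scale)"
    by (simp add: openin_open_Int)
  show "param_space E \<subseteq> closure (scaling_domain E tree_scale)"
    using tree_prod_nonzero_exists unfolding scaling_domain_tree_scale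
    by (auto dest: real_polynomial_function_dense_nonzero[OF real_polynomial_function_tree_prod subspace_param_space])
  show "continuous_on (scaling_domain E tree_scale) (tree_scale i)" for i
    by (rule continuous_on_tree_scale) (auto simp: scaling_domain_tree_scale tree_prod_nonzero_iff)
qed simp

lemma rescale_tree_scale_in_slice:
  assumes "A \<in> scaling_domain E tree_scale"
  shows "rescale tree_scale A \<in> slice"
proof -
  have A: "A \<in> param_space E" "\<And>v. v \<noteq> r \<Longrightarrow> A $ v $ par v \<noteq> 0" "\<And>v. tree_scale v A \<noteq> 0"
    using assms tree_scale_nonzero_iff[of A] by (auto simp: scaling_domain_def)
  then show ?thesis
    by (auto simp: slice_def rescale_eq_scale_by scale_by_param_space scale_by_nth tree_scale_step)
qed

lemma slice_fixed:
  assumes "B \<in> slice"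
  shows "B \<in> scaling_domain E tree_scale" "rescale tree_scale B = B"
proof -
  have tree: "B $ v $ par v = 1" if "v \<noteq> r" for v using assms that by (simp add: slice_def)
  show "B \<in> scaling_domain E tree_scale"
    using assms tree by (simp add: scaling_domain_tree_scale tree_prod_nonzero_iff slice_def)
  have "tree_scale v B = 1" for v
    by (induction v rule: par_induct) (auto simp: tree_scale_step tree)
  then show "rescale tree_scale B = B" by (simp add: rescale_def vec_eq_iff)
qed

text \<open>Rescaling retracts its domain onto the slice: it maps into the slice and fixes every
  point of it.\<close>

lemma image_rescale_tree_scale: "rescale tree_scale ` scaling_domain E tree_scale = slice"
proof (intro equalityI subsetI)
  fix B assume "B \<in> slice"
  then show "B \<in> rescale tree_scale ` scaling_domain E tree_scale"
    using slice_fixed by (intro rev_image_eqI[of B]) auto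
qed (use rescale_tree_scale_in_slice in blast)

end

lemma continuous_on_rescale:
  assumes "\<And>i. continuous_on S (f i)" "\<And>i A. A \<in> S \<Longrightarrow> f i A \<noteq> 0"
  shows "continuous_on S (rescale f)"
  unfolding rescale_def using assms
  by (intro continuous_on_vec_lambda continuous_on_divide continuous_on_mult continuous_on_component continuous_on_id) auto

context arborescence
begin

text \<open>The good points are dense in the parameter space as the nonvanishing set of one
  polynomial. Their conditions are invariant under scaling, so they survive the retraction onto the
  slice, where local injectivity applies.\<close>

lemma nondegenerate_imp_identifiable:
  assumes sc: "strongly_connected E" and A0: "A0 \<in> param_space E" "nondegenerate E r A0"
  shows "identifiable_on slice (double_charpoly r)"
proof -
  obtain p where p: "real_polynomial_function p" "p A0 \<noteq> 0"
    "\<And>A. A \<in> param_space E \<Longrightarrow> p A \<noteq> 0 \<Longrightarrow> nondegenerate E r A"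
    by (rule nondegenerate_polynomial[OF A0]) blast
  let ?q = "\<lambda>A. det (krylov_matrix r A) * det (krylov_matrix r (transpose A))"
  obtain A1 where A1: "A1 \<in> param_space E" "det (krylov_matrix r A1) \<noteq> 0"
    using strongly_connected_controllable[OF sc] by blast
  obtain A2 where A2: "A2 \<in> param_space E" "det (krylov_matrix r (transpose A2)) \<noteq> 0"
    using strongly_connected_observable[OF sc] by blast
  obtain A3 where A3: "A3 \<in> param_space E" "?q A3 \<noteq> 0"
    by (rule polynomial_functions_common_nonzero[OF real_polynomial_function_det_krylov
      real_polynomial_function_det_krylov_transpose subspace_param_space A1 A2]) simp
  have q: "real_polynomial_function ?q"
    by (intro real_polynomial_function.intros(4) real_polynomial_function_det_krylov
        real_polynomial_function_det_krylov_transpose)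
  obtain A4 where A4: "A4 \<in> param_space E" "p A4 * ?q A4 \<noteq> 0"
    by (rule polynomial_functions_common_nonzero[OF p(1) q subspace_param_space A0(1) p(2) A3]) simp
  define G where "G = {A \<in> param_space E. p A * ?q A \<noteq> 0}"
  have dense: "param_space E \<subseteq> closure G"
    unfolding G_def
    by (rule real_polynomial_function_dense_nonzero[OF real_polynomial_function.intros(4)[OF p(1) q]
          subspace_param_space A4])
  let ?D = "scaling_domain E tree_scale"
  let ?\<rho> = "rescale tree_scale"
  define U where "U = ?\<rho> ` (G \<inter> ?D)"
  have reparam: "openin (top_of_set (param_space E)) ?D" "\<And>i. continuous_on ?D (tree_scale i)"
    using scaling_reparametrization_tree_scale unfolding scaling_reparametrization_def by auto
  have cont: "continuous_on ?D ?\<rho>"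
    using reparam(2) by (intro continuous_on_rescale) (auto simp: scaling_domain_def)
  have good: "B \<in> slice \<and> nondegenerate E r B \<and> det (krylov_matrix r B) \<noteq> 0 \<and>
      det (krylov_matrix r (transpose B)) \<noteq> 0" if B: "B \<in> U" for B
  proof -
    obtain A where A: "A \<in> G" "A \<in> ?D" "B = scale_by (\<lambda>i. tree_scale i A) A"
      using B unfolding U_def rescale_eq_scale_by[symmetric] by blast
    have "tree_scale i A \<noteq> 0" for i using A(2) by (simp add: scaling_domain_def)
    moreover have "B \<in> slice"
      using rescale_tree_scale_in_slice[OF A(2)] A(3) by (simp add: rescale_eq_scale_by)
    ultimately show ?thesis
      using A p(3)[of A]
      by (auto simp: G_def det_krylov_scale_by det_krylov_transpose_scale_by intro!: nondegenerate_scale_by)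
  qed
  \<comment> \<open>A point \<open>B\<close> of the slice is a limit of good points of the parameter
    space; the retraction is continuous and fixes \<open>B\<close>, so their images approach
    \<open>B\<close> within the slice.\<close>
  have "slice \<subseteq> closure U"
  proof
    fix B assume B: "B \<in> slice"
    obtain O' where O': "open O'" "?D = param_space E \<inter> O'"
      using reparam(1) by (auto simp: openin_open)
    show "B \<in> closure U"
      unfolding closure_approachable
    proof (intro allI impI)
      fix e :: real assume "e > 0"
      then obtain d where d: "d > 0" "\<And>A. A \<in> ?D \<Longrightarrow> dist A B < d \<Longrightarrow> dist (?\<rho> A) (?\<rho> B) < e"
        using cont slice_fixed(1)[OF B] unfolding continuous_on_iff by metis
      have "B \<in> O'" using slice_fixed(1)[OF B] O'(2) by blast
      then obtain d' where d': "d' > 0" "ball B d' \<subseteq> O'"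
        using O'(1) open_contains_ball by blast
      have "B \<in> closure G" using dense B by (auto simp: slice_def)
      then obtain A where A: "A \<in> G" "dist A B < min d d'"
        using d(1) d'(1) unfolding closure_approachable by (metis min_less_iff_conj)
      then have "A \<in> ?D" using d'(2) O'(2) by (auto simp: G_def dist_commute)
      then have "?\<rho> A \<in> U" using A by (auto simp: U_def)
      moreover have "dist (?\<rho> A) B < e"
        using d(2)[OF \<open>A \<in> ?D\<close>] A(2) slice_fixed(2)[OF B] by simp
      ultimately show "\<exists>y\<in>U. dist y B < e" by blast
    qed
  qed
  moreover have "U \<subseteq> slice" using good by blast
  moreover have "\<exists>N. openin (top_of_set slice) N \<and> x \<in> N \<and> inj_on (double_charpoly r) N" if "x \<in> U" for x
    using good[OF that] double_charpoly_locally_injective[of x] by metis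
  ultimately show ?thesis unfolding identifiable_on_def by blast
qed

end

lemma full_rank_imp_identifiable:
  assumes "strongly_connected E" "B_full_column_rank E r"
  shows "has_identifiable_scaling_reparametrization E r"
proof -
  obtain par depth where "arborescence E r par depth"
    using strongly_connected_arborescence[OF assms(1)] .
  then interpret arborescence E r par depth .
  show ?thesis
    using scaling_reparametrization_tree_scale nondegenerate_imp_identifiable[OF assms(1)] assms(2)
    unfolding has_identifiable_scaling_reparametrization_def B_full_column_rank_iff_nondegenerate
    by (auto simp: image_rescale_tree_scale intro!: exI[of _ tree_scale])
qed


subsection \<open>Identifiability implies full rank\<close>

lemma polynomial_function_vec:
  fixes f :: "'a::real_normed_vector \<Rightarrow> 'b::euclidean_space^'n::finite"
  assumes "\<And>i. polynomial_function (\<lambda>x. f x $ i)"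
  shows "polynomial_function f"
  using assms unfolding polynomial_function_iff_Basis_inner
  by (auto simp: Basis_vec_def inner_axis)

lemma polynomial_function_Pair:
  fixes f :: "'a::real_normed_vector \<Rightarrow> 'b::euclidean_space" and g :: "'a \<Rightarrow> 'c::euclidean_space"
  assumes "polynomial_function f" "polynomial_function g"
  shows "polynomial_function (\<lambda>x. (f x, g x))"
  using assms unfolding polynomial_function_iff_Basis_inner
  by (auto simp: Basis_prod_def)

text \<open>To first order, the line in direction [X, A] is conjugation by exp(tX). As
  \<open>X\<close> kills the unit vector, A^k e moves with velocity X A^k e.\<close>

lemma krylov_directional_derivative:
  fixes A X :: "real^'n::finite^'n"
  assumes "X *v axis r 1 = 0"
  shows "((\<lambda>t. krylov r (A + t *\<^sub>R (X ** A - A ** X)) k) has_vector_derivative X *v krylov r A k) (at 0)"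
proof (induction k)
  case 0
  show ?case by (simp add: assms)
next
  case (Suc k)
  let ?C = "X ** A - A ** X" and ?k = "\<lambda>t. krylov r (A + t *\<^sub>R (X ** A - A ** X)) k"
  have "((\<lambda>t. A *v ?k t + t *\<^sub>R (?C *v ?k t)) has_vector_derivative
      A *v (X *v krylov r A k) + (0 *\<^sub>R (?C *v (X *v krylov r A k)) + 1 *\<^sub>R (?C *v ?k 0))) (at 0)"
    by (intro has_vector_derivative_add has_vector_derivative_scaleR DERIV_ident
        bounded_linear.has_vector_derivative[OF matrix_vector_mul_bounded_linear Suc])
  moreover have "krylov r (A + t *\<^sub>R ?C) (Suc k) = A *v ?k t + t *\<^sub>R (?C *v ?k t)" for t
    by (simp add: krylov_Suc matrix_vector_mult_add_rdistrib scaleR_matrix_vector_assoc)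
  moreover have "A *v (X *v krylov r A k) + (0 *\<^sub>R (?C *v (X *v krylov r A k)) + 1 *\<^sub>R (?C *v ?k 0)) =
      X *v krylov r A (Suc k)"
    by (simp add: krylov_Suc matrix_vector_mult_diff_rdistrib matrix_vector_mul_assoc)
  ultimately show ?case by simp
qed

section \<open>Smooth data on the full matrix space\<close>

text \<open>It extends maps from the parameter space to all matrices, so that statements about open
  sets of a Euclidean space become applicable.\<close>

definition param_projection :: "('n \<times> 'n) set \<Rightarrow> real^'n::finite^'n \<Rightarrow> real^'n^'n"
  where "param_projection E M = (\<chi> i j. if i = j \<or> (j, i) \<in> E then M $ i $ j else 0)"

lemma param_projection_in: "param_projection E M \<in> param_space E"
  by (auto simp: param_projection_def param_space_def)

lemma param_projection_id: "A \<in> param_space E \<Longrightarrow> param_projection E A = A"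
  by (auto simp: param_projection_def param_space_def vec_eq_iff)

lemma bounded_linear_param_projection: "bounded_linear (param_projection E)"
  unfolding linear_conv_bounded_linear[symmetric]
  by (intro linearI) (auto simp: param_projection_def vec_eq_iff)

text \<open>A polynomial substitute for \<open>double_charpoly\<close> with values in a Euclidean
  space, whose derivative along commutators is easy to compute.\<close>

definition hankel_data :: "'n::finite \<Rightarrow> real^'n^'n \<Rightarrow> (real^'n^'n) \<times> (real^'n^'n)"
  where "hankel_data r A =
    ((\<chi> i j. krylov r A (vertex_index i + vertex_index j) $ r),
     (\<chi> i j. krylov r A (Suc (vertex_index i + vertex_index j)) $ r))"

lemma polynomial_function_hankel_data: "polynomial_function (hankel_data r)"
  unfolding hankel_data_def
  by (intro polynomial_function_Pair polynomial_function_vec)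
    (simp_all add: real_polynomial_function_eq[symmetric] real_polynomial_function_krylov)

lemma hankel_data_eq_imp_double_charpoly_eq:
  fixes A A' :: "real^'n::finite^'n"
  assumes "hankel_data r A = hankel_data r A'"
    "det (krylov_matrix r A) \<noteq> 0" "det (krylov_matrix r (transpose A)) \<noteq> 0"
    "det (krylov_matrix r A') \<noteq> 0" "det (krylov_matrix r (transpose A')) \<noteq> 0"
  shows "double_charpoly r A = double_charpoly r A'"
proof -
  have h: "krylov r A (vertex_index i + vertex_index j) $ r = krylov r A' (vertex_index i + vertex_index j) $ r"
    "krylov r A (Suc (vertex_index i + vertex_index j)) $ r = krylov r A' (Suc (vertex_index i + vertex_index j)) $ r"
    for i j :: 'n
    using assms(1) by (simp_all add: hankel_data_def vec_eq_iff)
  obtain T where "invertible T" "T ** A = A' ** T" "T *v axis r 1 = axis r 1" "axis r 1 v* T = axis r 1"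
    by (rule realization_unique[OF h assms(2-)])
  then show ?thesis
    unfolding double_charpoly_eq_iff using similar_imp_charpolys_eq by blast
qed

context arborescence
begin

text \<open>
  Adding a diagonal matrix to \<open>X\<close> does not change the off-parameter entries of the commutator with
  \<open>A\<close>, and its \<open>n - 1\<close> free entries can be used to kill the commutator along the tree.
\<close>

lemma diagonal_correction:
  assumes A: "A \<in> param_space E" and tree: "\<And>v. v \<noteq> r \<Longrightarrow> A $ v $ par v \<noteq> 0"
    and X: "\<And>i j. (i, j) \<notin> B_cols r \<Longrightarrow> X $ i $ j = 0"
    and comm: "\<And>k l. (k, l) \<in> B_rows E \<Longrightarrow> (X ** A) $ k $ l = (A ** X) $ k $ l"
  obtains Y where "Y \<in> corner_free r" "\<And>i j. i \<noteq> j \<Longrightarrow> Y $ i $ j = X $ i $ j"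
    "Y ** A - A ** Y \<in> slice_directions"
proof -
  define M where "M = X ** A - A ** X"
  \<comment> \<open>Summed along the path to the root so that consecutive differences cancel the
    tree entries of \<open>M\<close>.\<close>
  define x where "x v = - (\<Sum>k<depth v. M $ (par ^^ k) v $ (par ^^ Suc k) v / A $ (par ^^ k) v $ (par ^^ Suc k) v)" for v
  have x_root: "x r = 0" by (simp add: x_def depth_root)
  have x_step: "x v = x (par v) - M $ v $ par v / A $ v $ par v" if "v \<noteq> r" for v
    unfolding x_def depth_par[OF that] sum.lessThan_Suc_shift by (simp add: funpow_swap1)
  define D where "D = (\<chi> i j. if i = j then x i else 0)"
  have DA: "(D ** A) $ k $ l = x k * A $ k $ l" for k l
    by (simp add: D_def matrix_matrix_mult_def if_distrib[where f = "\<lambda>x. x * _"] cong: if_cong)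
  have AD: "(A ** D) $ k $ l = A $ k $ l * x l" for k l
    by (simp add: D_def matrix_matrix_mult_def if_distrib[where f = "\<lambda>x. _ * x"] cong: if_cong)
  define Y where "Y = X + D"
  have C: "(Y ** A - A ** Y) $ k $ l = M $ k $ l + (x k - x l) * A $ k $ l" for k l
  proof -
    have "Y ** A = X ** A + D ** A" "A ** Y = A ** X + A ** D"
      by (simp_all add: Y_def matrix_add_ldistrib matrix_matrix_mult_def vec_eq_iff distrib_left distrib_right sum.distrib)
    then show ?thesis by (simp add: M_def DA AD algebra_simps)
  qed
  have "Y ** A - A ** Y \<in> slice_directions"
    unfolding slice_directions_def param_space_def mem_Collect_eq C
  proof (intro conjI allI impI)
    fix i j assume ij: "i \<noteq> j \<and> (j, i) \<notin> E"
    then have "M $ i $ j = 0" using comm[of i j] by (simp add: M_def B_rows_def)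
    moreover have "A $ i $ j = 0" using A ij by (simp add: param_space_def)
    ultimately show "M $ i $ j + (x i - x j) * A $ i $ j = 0" by simp
  next
    fix v assume "v \<noteq> r"
    then show "M $ v $ par v + (x v - x (par v)) * A $ v $ par v = 0"
      using tree by (simp add: x_step)
  qed
  moreover have "Y \<in> corner_free r"
    using X x_root by (auto simp: corner_free_def Y_def D_def B_cols_def)
  moreover have "Y $ i $ j = X $ i $ j" if "i \<noteq> j" for i j
    using that by (simp add: Y_def D_def)
  ultimately show thesis using that by blast
qed

text \<open>A kernel element \<open>X\<close>, corrected on the diagonal to \<open>Z\<close>, gives
  a commutator direction along which all data are stationary. An immersion forces it to be 0, so
  \<open>Z\<close> commutes with \<open>A\<close> and kills every A^k e; these vectors span the
  space.\<close>

lemma immersion_imp_nondegenerate: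
  fixes Y :: "real^'n^'n" and F :: "real^'n^'n \<Rightarrow> ((real^'n^'n) \<times> (real^'n^'n)) \<times> (real^'n^'n)"
  defines "A \<equiv> param_projection E Y"
    and "F \<equiv> \<lambda>Y. (hankel_data r (param_projection E Y), Y - slice_projection Y)"
  assumes der: "(F has_derivative F') (at Y)" and inj: "inj F'"
    and tree: "\<And>v. v \<noteq> r \<Longrightarrow> A $ v $ par v \<noteq> 0" and nz: "det (krylov_matrix r A) \<noteq> 0"
  shows "nondegenerate E r A"
  unfolding nondegenerate_def
proof (intro allI impI)
  fix X :: "real^'n^'n"
  assume X: "(\<forall>i j. (i, j) \<notin> B_cols r \<longrightarrow> X $ i $ j = 0) \<and>
    (\<forall>k l. (k, l) \<in> B_rows E \<longrightarrow> (X ** A) $ k $ l = (A ** X) $ k $ l)"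
  have A: "A \<in> param_space E" unfolding A_def by (rule param_projection_in)
  obtain Z where Z: "Z \<in> corner_free r" "\<And>i j. i \<noteq> j \<Longrightarrow> Z $ i $ j = X $ i $ j"
    "Z ** A - A ** Z \<in> slice_directions"
    using diagonal_correction[OF A tree, of X] X by metis
  define C where "C = Z ** A - A ** Z"
  have Zr: "Z *v axis r 1 = 0"
    using Z(1) unfolding matrix_vector_mult_basis by (simp add: corner_free_def column_def vec_eq_iff)
  have Zrow: "(Z *v v) $ r = 0" for v
    using Z(1) by (simp add: corner_free_def matrix_vector_mult_def)
  have "C \<in> param_space E" using Z(3) by (simp add: C_def slice_directions_def)
  then have proj: "param_projection E (Y + t *\<^sub>R C) = A + t *\<^sub>R C" for t
    using bounded_linear.linear[OF bounded_linear_param_projection[of E]]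
    by (simp add: linear_add linear_cmul param_projection_id A_def)
  have proj': "Y + t *\<^sub>R C - slice_projection (Y + t *\<^sub>R C) = Y - slice_projection Y" for t
    using bounded_linear.linear[OF bounded_linear_slice_projection] slice_projection_id[OF Z(3)]
    by (simp add: linear_add linear_cmul C_def)
  \<comment> \<open>The derivative is the \<open>r\<close>-th entry of a vector in the image of
    \<open>Z\<close>, which is 0 because row \<open>r\<close> of \<open>Z\<close> vanishes.\<close>
  have "((\<lambda>t. krylov r (A + t *\<^sub>R C) k $ r) has_vector_derivative (Z *v krylov r A k) $ r) (at 0)" for k
    unfolding C_def
    by (rule bounded_linear.has_vector_derivative[OF bounded_linear_vec_nth krylov_directional_derivative[OF Zr]])
  then have dk: "((\<lambda>t. krylov r (A + t *\<^sub>R C) k $ r) has_derivative (\<lambda>h. 0)) (at 0)" for k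
    by (simp add: has_vector_derivative_def Zrow)
  have "((\<lambda>t. F (Y + t *\<^sub>R C)) has_derivative (\<lambda>h. 0)) (at 0)"
  proof (subst has_derivative_componentwise_within, rule ballI)
    fix b :: "((real^'n^'n) \<times> (real^'n^'n)) \<times> (real^'n^'n)" assume "b \<in> Basis"
    then consider i j where "b = ((axis i (axis j 1), 0), 0)" | i j where "b = ((0, axis i (axis j 1)), 0)"
      | c where "b = (0, c)"
      by (auto simp: Basis_prod_def Basis_vec_def)
    then show "((\<lambda>t. F (Y + t *\<^sub>R C) \<bullet> b) has_derivative (\<lambda>h. 0 \<bullet> b)) (at 0)"
      by cases (simp_all add: F_def proj proj' hankel_data_def inner_axis dk)
  qed
  moreover have "((\<lambda>t. F (Y + t *\<^sub>R C)) has_derivative (\<lambda>h. F' (h *\<^sub>R C))) (at 0)"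
  proof -
    have "((\<lambda>t. Y + t *\<^sub>R C) has_derivative (\<lambda>h. h *\<^sub>R C)) (at 0)"
      by (auto intro!: derivative_eq_intros)
    moreover have "(F has_derivative F') (at (Y + 0 *\<^sub>R C))" using der by simp
    ultimately show ?thesis by (rule has_derivative_compose)
  qed
  ultimately have "(\<lambda>h :: real. F' (h *\<^sub>R C)) = (\<lambda>h. 0)"
    by (rule has_derivative_unique[symmetric])
  from fun_cong[OF this, of 1] have "F' C = F' 0"
    using linear_0[OF has_derivative_linear[OF der]] by simp
  then have "C = 0" using inj by (simp add: inj_eq)
  then have comm: "Z ** A = A ** Z" by (simp add: C_def)
  have "Z *v krylov r A k = 0" for k
  proof (induction k)
    case (Suc k)
    have "Z *v krylov r A (Suc k) = A *v (Z *v krylov r A k)"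
      by (simp add: krylov_Suc matrix_vector_mul_assoc comm)
    then show ?case by (simp add: Suc)
  qed (simp add: Zr)
  then have "Z ** krylov_matrix r A = 0"
    by (simp add: vec_eq_iff matrix_matrix_mult_def matrix_vector_mult_def krylov_matrix_def)
  moreover have "invertible (krylov_matrix r A)" using nz by (simp add: invertible_det_nz)
  ultimately have "Z = 0"
    by (metis matrix_inv_right matrix_mul_assoc matrix_mul_rid times0_left)
  then have "X $ i $ j = 0" for i j
    using Z(2)[of i j] X by (cases "i = j") (auto simp: B_cols_def)
  then show "X = 0" by (simp add: vec_eq_iff)
qed

text \<open>Continuity yields an open piece of the parameter space that is rescaled into a set of
  injectivity. There the data augmented by the tree entries are injective, hence an immersion at
  some point.\<close>

lemma identifiable_imp_nondegenerate:
  assumes sc: "strongly_connected E" and ident: "has_identifiable_scaling_reparametrization E r"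
  shows "\<exists>A\<in>param_space E. nondegenerate E r A"
proof -
  obtain f where f: "scaling_reparametrization E r f"
    and id: "identifiable_on (rescale f ` scaling_domain E f) (double_charpoly r)"
    using ident unfolding has_identifiable_scaling_reparametrization_def by blast
  let ?D = "scaling_domain E f" and ?\<rho> = "rescale f"
  have fr: "\<And>A. A \<in> param_space E \<Longrightarrow> f r A = 1" and D_open: "openin (top_of_set (param_space E)) ?D"
    and D_dense: "param_space E \<subseteq> closure ?D" and f_cont: "\<And>i. continuous_on ?D (f i)"
    using f unfolding scaling_reparametrization_def by blast+
  have f_nz: "f i A \<noteq> 0" if "A \<in> ?D" for i A using that by (simp add: scaling_domain_def)
  obtain U where U: "U \<subseteq> ?\<rho> ` ?D" "?\<rho> ` ?D \<subseteq> closure U"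
    "\<And>x. x \<in> U \<Longrightarrow> \<exists>N. openin (top_of_set (?\<rho> ` ?D)) N \<and> x \<in> N \<and> inj_on (double_charpoly r) N"
    using id unfolding identifiable_on_def by blast
  have "0 \<in> param_space E" by (simp add: param_space_def)
  then have "?D \<noteq> {}" using D_dense by auto
  then have "U \<noteq> {}" using U(2) by auto
  then obtain A0 N where A0: "A0 \<in> ?D" "?\<rho> A0 \<in> N" and N: "openin (top_of_set (?\<rho> ` ?D)) N"
    and N_inj: "inj_on (double_charpoly r) N"
    using U(1,3) by blast
  have "openin (top_of_set ?D) (?D \<inter> ?\<rho> -` N)"
    using continuous_on_rescale[OF f_cont f_nz] N by (intro continuous_openin_preimage) auto
  then have "openin (top_of_set (param_space E)) (?D \<inter> ?\<rho> -` N)"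
    using D_open by (rule openin_trans)
  \<comment> \<open>\<open>S\<close> cuts out the parameters whose rescaled matrix lies in the set
    \<open>N\<close> on which \<open>double_charpoly r\<close> is injective.\<close>
  then obtain S where S: "open S" "?D \<inter> ?\<rho> -` N = param_space E \<inter> S"
    by (auto simp: openin_open)
  let ?q = "\<lambda>A. det (krylov_matrix r A) * det (krylov_matrix r (transpose A))"
  obtain A1 where A1: "A1 \<in> param_space E" "det (krylov_matrix r A1) \<noteq> 0"
    using strongly_connected_controllable[OF sc] by blast
  obtain A2 where A2: "A2 \<in> param_space E" "det (krylov_matrix r (transpose A2)) \<noteq> 0"
    using strongly_connected_observable[OF sc] by blast
  obtain A3 where A3: "A3 \<in> param_space E" "?q A3 \<noteq> 0"
    by (rule polynomial_functions_common_nonzero[OF real_polynomial_function_det_krylov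
      real_polynomial_function_det_krylov_transpose subspace_param_space A1 A2]) simp
  obtain A4 where A4: "A4 \<in> param_space E" "tree_prod A4 \<noteq> 0"
    using tree_prod_nonzero_exists by blast
  have q: "real_polynomial_function ?q"
    by (intro real_polynomial_function.intros(4) real_polynomial_function_det_krylov
        real_polynomial_function_det_krylov_transpose)
  obtain A5 where A5: "A5 \<in> param_space E" "?q A5 * tree_prod A5 \<noteq> 0"
    by (rule polynomial_functions_common_nonzero[OF q real_polynomial_function_tree_prod
      subspace_param_space A3 A4]) simp
  define p where "p A = ?q A * tree_prod A" for A
  have p: "real_polynomial_function p"
    unfolding p_def by (rule real_polynomial_function.intros(4)[OF q real_polynomial_function_tree_prod])
  have p_nz: "det (krylov_matrix r A) \<noteq> 0" "det (krylov_matrix r (transpose A)) \<noteq> 0"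
    "v \<noteq> r \<Longrightarrow> A $ v $ par v \<noteq> 0" if "p A \<noteq> 0" for A v
    using that by (auto simp: p_def tree_prod_nonzero_iff)
  have "param_space E \<subseteq> closure {A \<in> param_space E. p A \<noteq> 0}"
    using A5 by (intro real_polynomial_function_dense_nonzero[OF p subspace_param_space A5(1)]) (simp add: p_def)
  moreover have "A0 \<in> param_space E \<inter> S" using A0 S(2) by blast
  ultimately have "S \<inter> {A \<in> param_space E. p A \<noteq> 0} \<noteq> {}"
    using open_Int_closure_eq_empty[OF S(1)] by blast
  then obtain A6 where A6: "A6 \<in> S" "A6 \<in> param_space E" "p A6 \<noteq> 0" by blast
  have "continuous_on UNIV p"
    using p by (simp add: continuous_on_polymonial_function real_polynomial_function_eq)
  then have S': "open (S \<inter> {A. p A \<noteq> 0})"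
    using S(1) by (intro open_Int open_Collect_neq) auto
  \<comment> \<open>Equal values force equal rescaled matrices. Equal nonzero tree entries then make
    the scaling factors agree from the root outwards, so the matrices themselves coincide.\<close>
  have same: "A = A'"
    if A: "A \<in> param_space E" "A \<in> S" and A': "A' \<in> param_space E" "A' \<in> S" and "p A \<noteq> 0"
      and c: "double_charpoly r A = double_charpoly r A'"
      and tree: "\<And>v. v \<noteq> r \<Longrightarrow> A $ v $ par v = A' $ v $ par v" for A A'
  proof -
    have AD: "A \<in> ?D" "?\<rho> A \<in> N" and AD': "A' \<in> ?D" "?\<rho> A' \<in> N"
      using A A' S(2) by blast+
    have "double_charpoly r (?\<rho> A) = double_charpoly r (?\<rho> A')"
      using c double_charpoly_rescale[of f A r, OF f_nz[OF AD(1)]]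
        double_charpoly_rescale[of f A' r, OF f_nz[OF AD'(1)]] by simp
    then have "?\<rho> A = ?\<rho> A'" using N_inj AD(2) AD'(2) by (auto dest: inj_onD)
    then have entry: "A $ i $ j * f i A / f j A = A' $ i $ j * f i A' / f j A'" for i j
      by (simp add: rescale_def vec_eq_iff)
    have "f v A = f v A'" for v
    proof (induction v rule: par_induct)
      case root
      show ?case using A A' fr by simp
    next
      case (step v)
      then show ?case
        using entry[of v "par v"] tree[of v] p_nz(3)[OF \<open>p A \<noteq> 0\<close>, of v] f_nz[OF AD(1), of "par v"]
        by (auto simp: field_simps)
    qed
    then show "A = A'"
      using entry f_nz[OF AD(1)] f_nz[OF AD'(1)] by (simp add: vec_eq_iff)
  qed
  \<comment> \<open>The second component records the tree entries and also the coordinates forgotten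
    by \<open>param_projection\<close>, which makes \<open>F\<close> injective on an open set of the
    full matrix space.\<close>
  define F where "F Y = (hankel_data r (param_projection E Y), Y - slice_projection Y)" for Y
  define W where "W = param_projection E -` (S \<inter> {A. p A \<noteq> 0})"
  have "open W"
    unfolding W_def
    by (intro open_vimage S' linear_continuous_on bounded_linear_param_projection)
  have "inj_on F W"
  proof (rule inj_onI)
    fix Y Y' assume Y: "Y \<in> W" "Y' \<in> W" and eq: "F Y = F Y'"
    let ?A = "param_projection E Y" and ?A' = "param_projection E Y'"
    have mod_dir: "(Y - slice_projection Y) $ i $ j = (Y' - slice_projection Y') $ i $ j" for i j
      using eq by (simp add: F_def)
    have AS: "?A \<in> S" "p ?A \<noteq> 0" "?A' \<in> S" "p ?A' \<noteq> 0" using Y by (auto simp: W_def)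
    have "hankel_data r ?A = hankel_data r ?A'" using eq by (simp add: F_def)
    then have "double_charpoly r ?A = double_charpoly r ?A'"
      by (rule hankel_data_eq_imp_double_charpoly_eq) (use AS p_nz in auto)
    moreover have "?A $ v $ par v = ?A' $ v $ par v" if "v \<noteq> r" for v
      using mod_dir[of v "par v"] that par_neq[OF that]
      by (auto simp: slice_projection_def param_projection_def)
    ultimately have "?A = ?A'"
      by (intro same param_projection_in AS)
    then have entries: "?A $ i $ j = ?A' $ i $ j" for i j by simp
    have "Y $ i $ j = Y' $ i $ j" for i j
    proof (cases "i = j \<or> (j, i) \<in> E")
      case True
      then show ?thesis using entries[of i j] by (simp add: param_projection_def)
    next
      case False
      then show ?thesis using mod_dir[of i j] by (simp add: slice_projection_def)
    qed
    then show "Y = Y'" by (simp add: vec_eq_iff)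
  qed
  have "polynomial_function F"
    unfolding F_def
    by (intro polynomial_function_Pair polynomial_function_bounded_linear bounded_linear_sub
        bounded_linear_ident bounded_linear_slice_projection
        polynomial_function_compose[OF polynomial_function_bounded_linear[OF bounded_linear_param_projection]
          polynomial_function_hankel_data, unfolded o_def])
  then obtain F' where "\<And>x. (F has_derivative blinfun_apply (F' x)) (at x)" "continuous_on UNIV F'"
    by (rule polynomial_function_C1) blast
  note F' = this
  have "A6 \<in> W" using A6 by (simp add: W_def param_projection_id)
  then have "\<exists>Y\<in>W. inj (blinfun_apply (F' Y))"
    using \<open>open W\<close> \<open>inj_on F W\<close>
    by (intro inj_C1_imp_inj_derivative[of W F F'] F' continuous_on_subset[OF F'(2)]) auto
  then obtain Y where Y: "Y \<in> W" "inj (blinfun_apply (F' Y))" by blast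
  have "p (param_projection E Y) \<noteq> 0" using Y(1) by (simp add: W_def)
  then have "nondegenerate E r (param_projection E Y)"
    using Y(2) F'(1)[of Y] p_nz unfolding F_def[abs_def] by (intro immersion_imp_nondegenerate) auto
  then show ?thesis using param_projection_in by blast
qed

end

theorem theorem1p1:
  fixes E :: "('n::finite \<times> 'n) set" and r :: 'n
  assumes "simple_digraph E" and "strongly_connected E"
  shows "has_identifiable_scaling_reparametrization E r \<longleftrightarrow> B_full_column_rank E r"
proof
  assume "has_identifiable_scaling_reparametrization E r"
  moreover obtain par depth where "arborescence E r par depth"
    using strongly_connected_arborescence[OF assms(2)] .
  ultimately show "B_full_column_rank E r"
    unfolding B_full_column_rank_iff_nondegenerate
    using arborescence.identifiable_imp_nondegenerate assms(2) by blast
qed (rule full_rank_imp_identifiable[OF assms(2)])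

end
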